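(* Let $X\subset\mathbb{C}$ be a nondegenerate non-separating continuum with $O\in\mathrm{Bd}(X)$ and $X\subset B(O,1)$, and let $\widehat X=\exp^{-1}(X\setminus\{O\})$. Then the following are equivalent: (1) $O$ is accessible from $\mathbb{C}^*\setminus X$; (2) $\widehat X=A\cup B$, where $A$ and $B$ are non-empty, disjoint and closed sets such that $A$ lies above $B$, and for all $x\in\mathbb{R}$ there exist $y_1<y_2$ in $\mathbb{R}$ such that $$\pi_1^{-1}([x,\infty))\cap\pi_2^{-1}([y_2,\infty))\cap B=\emptyset\quad\text{and}\quad \pi_1^{-1}([x,\infty))\cap\pi_2^{-1}((-\infty,y_1])\cap A=\emptyset .$$
   Context: $O$ is the origin of $\mathbb{C}$, $B(O,1)$ is the open unit disk, also denoted $\mathbb{D}$, and $\mathbb{C}^*=\mathbb{C}\cup\{\infty\}$. A continuum is a compact connected set; $X\subset\mathbb{C}$ is non-separating if $\mathbb{C}\setminus X$ is connected. $\pi_1,\pi_2:\mathbb{C}\to\mathbb{R}$ are the real and imaginary part. $\exp:\mathbb{C}\to\mathbb{C}\setminus\{O\}$ is $\exp(z)=e^z$. Since $X\subset B(O,1)$, $\widehat X$ lies in $\{\pi_1<0\}$. Accessible: let $\varphi:\mathbb{D}\to\mathbb{C}^*\setminus X$ be the conformal isomorphism with $\varphi(O)=\infty$ and $\varphi'(O)>0$ (i.e. $\lim_{z\to 0}z\varphi(z)>0$). For an angle $\theta$ the external ray is $R_\theta=\varphi(\{re^{i\theta}: 0\le r<1\})$; it lands on $x$ if $\overline{R_\theta}\setminus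 R_\theta=\{x\}$. A point $x\in X$ is accessible from $\mathbb{C}^*\setminus X$ if some external ray $R_\theta$ lands on $x$. Lies above: let $C$ and $D$ be two distinct components of $\widehat X$. $C$ lies above $D$ if there is a path $s:[0,1]\to\pi_1^{-1}((-\infty,0])\setminus C$ with $s(0)\in D$, $s(1)=O$, such that, with $R=s([0,1])\cup([0,\infty)\times\{0\})$, $C$ lies in the (unbounded) component of $\mathbb{C}\setminus[D\cup R]$ which contains the point $1+2\pi i$. If $\widehat X=A\cup B$ with $A,B$ disjoint closed sets, then $A$ lies above $B$ if every component of $A$ lies above every component of $B$. *)

theory Defs
  imports "HOL-Complex_Analysis.Complex_Analysis"
begin

definition nondegenerate_nonseparating_continuum :: "complex set \<Rightarrow> bool" where
  "nondegenerate_nonseparating_continuum X \<longleftrightarrow>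
     compact X \<and> connected X \<and> (\<exists>a\<in>X. \<exists>b\<in>X. a \<noteq> b) \<and> connected (- X)"

definition hat :: "complex set \<Rightarrow> complex set" where
  "hat X = exp -` (X - {0})"

text \<open>
  The normalised conformal isomorphism from the unit disk onto the complement of \<open>X\<close> in the
  Riemann sphere. A map into the sphere is represented, as usual for meromorphic functions, by a
  complex-valued function with a pole: the only point mapped to \<open>\<infinity>\<close> is \<open>0\<close>, where \<open>\<phi>\<close> has a pole
  and where the value \<open>\<phi> 0\<close> of the HOL function is irrelevant. The last conjunct is the
  normalisation of the derivative at \<open>0\<close>.
\<close>

definition exterior_conformal_iso :: "complex set \<Rightarrow> (complex \<Rightarrow> complex) \<Rightarrow> bool" where
  "exterior_conformal_iso X \<phi> \<longleftrightarrow>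
     \<phi> holomorphic_on (ball 0 1 - {0}) \<and>
     is_pole \<phi> 0 \<and>
     bij_betw \<phi> (ball 0 1 - {0}) (- X) \<and>
     (\<exists>c::real. c > 0 \<and> ((\<lambda>z. z * \<phi> z) \<longlongrightarrow> complex_of_real c) (at 0))"

text \<open>
  The finite part of the external ray of angle \<open>\<theta>\<close>; the full ray also contains \<open>\<infinity>\<close>, the image
  of \<open>r = 0\<close>. As \<open>\<infinity>\<close> belongs to the ray, the closure of the ray minus the ray is the same
  set whether it is formed in the sphere or, with the finite part, in the plane.
\<close>

definition external_ray :: "(complex \<Rightarrow> complex) \<Rightarrow> real \<Rightarrow> complex set" where
  "external_ray \<phi> \<theta> = (\<lambda>r. \<phi> (rcis r \<theta>)) ` {0<..<1}"

definition ray_lands :: "(complex \<Rightarrow> complex) \<Rightarrow> real \<Rightarrow> complex \<Rightarrow> bool" where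
  "ray_lands \<phi> \<theta> x \<longleftrightarrow> closure (external_ray \<phi> \<theta>) - external_ray \<phi> \<theta> = {x}"

text \<open>
  On the punctured disk, \<open>\<phi>\<close> is determined by \<open>X\<close>; only its value at \<open>0\<close> is not, so it is
  quantified rather than chosen.
\<close>

definition accessible :: "complex set \<Rightarrow> complex \<Rightarrow> bool" where
  "accessible X x \<longleftrightarrow>
     x \<in> X \<and> (\<exists>\<phi>. exterior_conformal_iso X \<phi> \<and> (\<exists>\<theta>. ray_lands \<phi> \<theta> x))"

text \<open>Intended for distinct components \<open>C\<close> and \<open>D\<close> of \<^term>\<open>hat X\<close>.\<close>

definition lies_above :: "complex set \<Rightarrow> complex set \<Rightarrow> bool" where
  "lies_above C D \<longleftrightarrow>
     (\<exists>s. path s \<and> path_image s \<subseteq> Re -` {..0} - C \<and>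
          pathstart s \<in> D \<and> pathfinish s = 0 \<and>
          (let R = path_image s \<union> complex_of_real ` {0..} in
           C \<subseteq> connected_component_set (- (D \<union> R)) (Complex 1 (2 * pi))))"

text \<open>
  Intended for disjoint closed sets with union \<^term>\<open>hat X\<close>; the components of \<open>A\<close> and of \<open>B\<close>
  are then components of \<^term>\<open>hat X\<close>.
\<close>

definition lies_above_set :: "complex set \<Rightarrow> complex set \<Rightarrow> bool" where
  "lies_above_set A B \<longleftrightarrow> (\<forall>C\<in>components A. \<forall>D\<in>components B. lies_above C D)"

end

theory Submission
  imports Defs
begin

text \<open>
  Everything takes place on the logarithmic scale. The exterior map \<open>\<phi>\<close> lifts through \<open>exp\<close> to a
  homeomorphism \<open>\<Psi>\<close> (the constant \<open>lift\<close> below) of the left half plane onto the complement of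
  \<open>hat X\<close> with \<open>exp (\<Psi> w) = \<phi> (exp w)\<close>. The half-line \<open>Im w = \<theta>\<close> corresponds to the ray of angle \<open>\<theta>\<close>,
  and that ray lands at \<open>0\<close> exactly if \<open>\<phi> (exp w)\<close> tends to \<open>0\<close> as \<open>w\<close> runs along the half-line towards
  the imaginary axis.

  From a landing ray to a separation. The end of a ray that lands at \<open>0\<close> contains an arc \<open>J\<close> that
  leads from a circle around \<open>X\<close> to \<open>0\<close> and meets \<open>X\<close> in \<open>0\<close> only (\<open>end_of_landing_ray\<close>). Prolong \<open>J\<close>
  radially to \<open>\<infinity>\<close>. The result is an arc in the sphere, so its complement \<open>S\<close> in the plane is connected and
  simply connected (\<open>slit_plane\<close>) and carries a branch \<open>L\<close> of the logarithm. The preimage of \<open>S\<close> under \<open>exp\<close>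
  consists of the sheets \<open>L(S) + 2 pi i n\<close>, which are stacked vertically. Let \<open>A\<close> be the part of \<open>hat X\<close>
  in the sheets with \<open>n \<ge> 0\<close> and \<open>B\<close> the part in the sheets with \<open>n < 0\<close>. The bounds in half planes hold
  because \<open>L\<close> is bounded on compact parts of \<open>X - {0}\<close>. Inside its own sheet every point of \<open>hat X\<close> can
  be joined to the imaginary axis, from a sheet \<open>n < 0\<close> at a negative height and from a sheet \<open>n \<ge> 0\<close> at a
  positive height, and this makes \<open>A\<close> lie above \<open>B\<close> (\<open>lies_above_sheets\<close>).

  From a separation to a landing ray. Let \<open>q z = dist(z, A) - dist(z, B)\<close>. By the bounds in half planes
  and by periodicity, \<open>q < 0\<close> far up and \<open>q > 0\<close> far down in every vertical strip; hence the zero set of \<open>q\<close>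
  meets every vertical strip in a compact set, and it misses \<open>hat X\<close>. As \<open>\<Psi>\<close> is a homeomorphism, the set
  \<open>\<Gamma> = {q \<circ> \<Psi> = 0}\<close> can approach a point of the imaginary axis only with \<open>Re \<Psi> \<rightarrow> -\<infinity>\<close>, that is, with
  \<open>\<phi> (exp w) \<rightarrow> 0\<close> (\<open>small_on_level_set\<close>). Since \<open>\<Psi>\<close> reverses up and down, \<open>q \<circ> \<Psi>\<close> is negative on some
  half-line far down and positive on some half-line far up, at least close to the imaginary axis. If \<open>i t\<close> is the highest boundary point on the
  imaginary axis of the component of \<open>{q \<circ> \<Psi> < 0}\<close> which contains the lower half-line, then every small
  semicircle about \<open>i t\<close> must meet \<open>\<Gamma>\<close> (\<open>ex_point_with_crossing_semicircles\<close>). So \<open>\<phi> \<circ> exp\<close> is small at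
  some point of every small semicircle about \<open>i t\<close>.

  The length-area principle turns this into convergence along the half-line that ends at \<open>i t\<close>. An injective
  holomorphic map \<open>G\<close> with bounded image has finite energy, because the integral of \<open>|G'|\<^sup>2\<close> is the
  area of the image. Hence all but few of the semicircles have short images, and on those \<open>\<phi> \<circ> exp\<close> is
  small throughout; Cauchy's estimate for the derivative bridges the small gaps between consecutive
  good radii (\<open>ray_lands_if_semicircles_small\<close>). The same principle provides the two half-lines used
  as barriers (\<open>ex_ray_landing_or_bounded_lift\<close>).
\<close>

section \<open>Energy and area\<close>

text \<open>
  The change of variables theorem for integrals speaks about \<open>real^2\<close>; these two mutually inverse isometries
  carry it over to complex functions.
\<close>
definition vec_of_complex :: "complex \<Rightarrow> real^2" where
  "vec_of_complex z = vector [Re z, Im z]"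
definition complex_of_vec :: "real^2 \<Rightarrow> complex" where
  "complex_of_vec x = Complex (x$1) (x$2)"

lemma vec_of_complex_inverse [simp]: "complex_of_vec (vec_of_complex z) = z"
  by (simp add: vec_of_complex_def complex_of_vec_def)
lemma complex_of_vec_inverse [simp]: "vec_of_complex (complex_of_vec x) = x"
  by (simp add: vec_of_complex_def complex_of_vec_def vec_eq_iff forall_2)

lemma bounded_linear_vec_of_complex: "bounded_linear vec_of_complex"
  unfolding linear_conv_bounded_linear[symmetric]
  by (rule linearI) (auto simp: vec_of_complex_def vec_eq_iff forall_2)
lemma bounded_linear_complex_of_vec: "bounded_linear complex_of_vec"
  unfolding linear_conv_bounded_linear[symmetric]
  by (rule linearI) (auto simp: complex_of_vec_def complex_eq_iff)

text \<open>
  Multiplication by \<open>c\<close> is a rotation followed by a dilation with factor \<open>norm c\<close>, hence multiplies areas by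
  \<open>(norm c)\<^sup>2\<close>.
\<close>
lemma det_vec_complex_mult:
  "det (matrix (\<lambda>x. vec_of_complex (c * complex_of_vec x))) = (norm c)\<^sup>2"
  by (simp add: det_2 matrix_def vec_of_complex_def complex_of_vec_def axis_def cmod_power2)
     (simp add: power2_eq_square)

text \<open>
  Allows the iterated integrals of a product measure to be used for the measure on \<open>real^2\<close>.
\<close>
lemma distr_lborel_real2: "distr lborel borel (\<lambda>x::real^2. (x$1, x$2)) = (lborel :: (real \<times> real) measure)"
proof (rule lborel_eqI[symmetric])
  fix l u :: "real \<times> real"
  assume le: "\<And>b. b \<in> Basis \<Longrightarrow> l \<bullet> b \<le> u \<bullet> b"
  have 1: "fst l \<le> fst u" "snd l \<le> snd u"
    using le[of "(1,0)"] le[of "(0,1)"] by (auto simp: Basis_prod_def inner_prod_def)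
  have m: "(\<lambda>x::real^2. (x$1, x$2)) \<in> borel_measurable borel"
    by (intro borel_measurable_continuous_onI continuous_intros)
  have eq: "(\<lambda>x::real^2. (x$1, x$2)) -` box l u = box (vector [fst l, snd l]) (vector [fst u, snd u])"
    by (auto simp: box_def Basis_prod_def inner_prod_def Basis_vec_def forall_2 inner_axis)
  have "emeasure (distr lborel borel (\<lambda>x::real^2. (x$1, x$2))) (box l u) = emeasure lborel (box (vector [fst l, snd l]::real^2) (vector [fst u, snd u]))"
    by (subst emeasure_distr) (auto simp: m eq)
  also have "\<dots> = (\<Prod>b\<in>Basis. (u - l) \<bullet> b)"
    using 1
    by (subst emeasure_lborel_box)
       (auto simp: Basis_vec_def forall_2 exhaust_2 inner_axis Basis_prod_def UNIV_2 axis_eq_axis inner_diff_left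
         inner_prod_def mult.commute)
  finally show "emeasure (distr lborel borel (\<lambda>x::real^2. (x$1, x$2))) (box l u) = (\<Prod>b\<in>Basis. (u - l) \<bullet> b)" .
qed simp

text \<open>
  The integrand of the Dirichlet integral of \<open>G\<close>, extended by \<open>0\<close> outside \<open>S\<close> so that its line integrals
  can be taken over all of \<open>real\<close>.
\<close>
definition energy_density :: "complex set \<Rightarrow> (complex \<Rightarrow> complex) \<Rightarrow> real \<Rightarrow> real \<Rightarrow> ennreal" where
  "energy_density S G x y = indicator S (Complex x y) * ennreal ((norm (deriv G (Complex x y)))\<^sup>2)"

lemma measurable_energy_density:
  assumes S: "open S" and G: "G holomorphic_on S"
  shows "(\<lambda>p. energy_density S G (fst p) (snd p)) \<in> borel_measurable (borel :: (real \<times> real) measure)"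
proof -
    define P where "P = (\<lambda>p. Complex (fst p) (snd p)) -` S"
    have c: "continuous_on A (\<lambda>p. Complex (fst p) (snd p))" for A
      unfolding Complex_eq by (intro continuous_intros)
    have "open P" unfolding P_def by (intro open_vimage S c)
    moreover have "continuous_on P (\<lambda>p. (norm (deriv G (Complex (fst p) (snd p))))\<^sup>2)"
      unfolding P_def
      by (intro continuous_intros continuous_on_compose2[OF holomorphic_on_imp_continuous_on[OF holomorphic_deriv[OF G S]]] c) auto
    ultimately have "(\<lambda>p. indicator P p *\<^sub>R (norm (deriv G (Complex (fst p) (snd p))))\<^sup>2) \<in> borel_measurable borel"
      by (intro borel_measurable_continuous_on_indicator) (auto simp: borel_open)
    hence "(\<lambda>p. ennreal (indicator P p *\<^sub>R (norm (deriv G (Complex (fst p) (snd p))))\<^sup>2)) \<in> borel_measurable borel"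
      by measurable
    also have "(\<lambda>p. ennreal (indicator P p *\<^sub>R (norm (deriv G (Complex (fst p) (snd p))))\<^sup>2)) =
       (\<lambda>p. energy_density S G (fst p) (snd p))"
      by (auto simp: fun_eq_iff energy_density_def P_def indicator_def)
    finally show ?thesis .
qed

text \<open>
  By the change of variables formula the energy is the area of \<open>G ` S\<close>.
\<close>
lemma finite_energy:
  assumes S: "open S" and G: "G holomorphic_on S" "inj_on G S" and b: "bounded (G ` S)"
  shows "(\<integral>\<^sup>+ p. energy_density S G (fst p) (snd p) \<partial>(lborel :: (real \<times> real) measure)) < \<infinity>"
proof -
  define T where "T = vec_of_complex ` S"
  have Teq: "T = complex_of_vec -` S"
    unfolding T_def by (auto simp: image_iff) (metis complex_of_vec_inverse)
  have T: "open T" unfolding Teq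
    by (intro open_vimage S linear_continuous_on bounded_linear_complex_of_vec)
  define g where "g = vec_of_complex \<circ> G \<circ> complex_of_vec"
  define g' where "g' x h = vec_of_complex (deriv G (complex_of_vec x) * complex_of_vec h)" for x h
  have der: "(g has_derivative g' x) (at x within T)" if "x \<in> T" for x
  proof -
    have "(G has_field_derivative deriv G (complex_of_vec x)) (at (complex_of_vec x))"
      using holomorphic_derivI[OF G(1) S] that by (auto simp: Teq)
    hence "(G has_derivative (*) (deriv G (complex_of_vec x))) (at (complex_of_vec x))"
      by (simp add: has_field_derivative_def)
    hence "((\<lambda>x. G (complex_of_vec x)) has_derivative (\<lambda>h. deriv G (complex_of_vec x) * complex_of_vec h)) (at x)"
      by (rule has_derivative_compose[OF bounded_linear_imp_has_derivative[OF bounded_linear_complex_of_vec]])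
    hence "((\<lambda>x. vec_of_complex (G (complex_of_vec x))) has_derivative (\<lambda>h. vec_of_complex (deriv G (complex_of_vec x) * complex_of_vec h))) (at x)"
      by (rule bounded_linear.has_derivative[OF bounded_linear_vec_of_complex])
    thus ?thesis unfolding g_def g'_def o_def by (rule has_derivative_at_withinI)
  qed
  have inj: "inj_on g T"
    using G(2) unfolding g_def T_def inj_on_def by (auto) (metis vec_of_complex_inverse)
  have im: "g ` T = vec_of_complex ` G ` S"
    unfolding g_def T_def by (auto simp: image_image)
  have "open (G ` S)" using open_mapping_thm3[OF G(1) S G(2)] .
  moreover have "g ` T = complex_of_vec -` (G ` S)"
    unfolding im by (auto simp: image_iff) (metis complex_of_vec_inverse)
  ultimately have "open (g ` T)"
    by (simp add: open_vimage linear_continuous_on bounded_linear_complex_of_vec)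
  moreover have "bounded (g ` T)"
    unfolding im by (rule bounded_linear_image[OF b bounded_linear_vec_of_complex])
  ultimately have "g ` T \<in> lmeasurable" by (rule lmeasurable_open[rotated])
  hence "(\<lambda>x. 1 :: real^1) absolutely_integrable_on (g ` T)"
    using absolutely_integrable_on_const by blast
  hence "(\<lambda>x. \<bar>det (matrix (g' x))\<bar> *\<^sub>R (1::real^1)) absolutely_integrable_on T"
    using absolutely_integrable_change_of_variables[OF _ der inj, of "\<lambda>x. 1 :: real^1"] T lmeasurable_open
    by (simp add: borel_open)
  hence "(\<lambda>x. norm (\<bar>det (matrix (g' x))\<bar> *\<^sub>R (1::real^1))) absolutely_integrable_on T"
    by (rule absolutely_integrable_norm[unfolded o_def])
  hence "(\<lambda>x. (norm (deriv G (complex_of_vec x)))\<^sup>2) absolutely_integrable_on T"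
    unfolding g'_def det_vec_complex_mult by simp
  hence *: "set_integrable lebesgue T (\<lambda>x. (norm (deriv G (complex_of_vec x)))\<^sup>2)" .
  have cont: "continuous_on T (\<lambda>x. (norm (deriv G (complex_of_vec x)))\<^sup>2)"
    unfolding Teq
    by (intro continuous_intros continuous_on_compose2[OF holomorphic_on_imp_continuous_on[OF holomorphic_deriv[OF G(1) S]]]
         linear_continuous_on bounded_linear_complex_of_vec) auto
  have mb: "(\<lambda>x. indicator T x *\<^sub>R (norm (deriv G (complex_of_vec x)))\<^sup>2) \<in> borel_measurable borel"
    using borel_measurable_continuous_on_indicator[OF _ cont] T by (simp add: borel_open)
  have "integrable lborel (\<lambda>x. indicator T x *\<^sub>R (norm (deriv G (complex_of_vec x)))\<^sup>2)"
    using * integrable_completion[of _ lborel] mb unfolding set_integrable_def by auto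
  hence fin: "(\<integral>\<^sup>+ x. ennreal (norm (indicator T x *\<^sub>R (norm (deriv G (complex_of_vec x)))\<^sup>2)) \<partial>lborel) < \<infinity>"
    by (simp add: integrable_iff_bounded)
  have "(\<integral>\<^sup>+ p. energy_density S G (fst p) (snd p) \<partial>(lborel :: (real \<times> real) measure))
    = (\<integral>\<^sup>+ x. indicator S (complex_of_vec x) * ennreal ((norm (deriv G (complex_of_vec x)))\<^sup>2) \<partial>lborel)"
    unfolding distr_lborel_real2[symmetric] energy_density_def
    by (subst nn_integral_distr) (auto simp: measurable_energy_density[OF S G(1), unfolded energy_density_def] complex_of_vec_def intro!: borel_measurable_continuous_onI continuous_intros)
  also have "\<dots> = (\<integral>\<^sup>+ x. ennreal (norm (indicator T x *\<^sub>R (norm (deriv G (complex_of_vec x)))\<^sup>2)) \<partial>lborel)"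
    by (intro nn_integral_cong) (auto simp: Teq indicator_def)
  finally show ?thesis using fin by simp
qed

text \<open>
  The Cauchy-Schwarz inequality: the chord is at most the length, and the square of the length is at
  most the duration times the energy.
\<close>
lemma chord_energy_bound:
  fixes F :: "real \<Rightarrow> complex"
  assumes ab: "a \<le> b"
    and der: "\<And>t. t \<in> {a..b} \<Longrightarrow> (F has_vector_derivative F' t) (at t within {a..b})"
    and cont: "continuous_on {a..b} F'" and J: "0 \<le> J"
    and E: "(\<integral>\<^sup>+ t. indicator {a..b} t * ennreal ((norm (F' t))\<^sup>2) \<partial>lborel) \<le> ennreal J"
  shows "(norm (F b - F a))\<^sup>2 \<le> (b - a) * J"
proof (cases "a = b")
  case False
  with ab have ab': "a < b" by simp
  define N where "N = integral {a..b} (\<lambda>t. norm (F' t))"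
  define I where "I = integral {a..b} (\<lambda>t. (norm (F' t))\<^sup>2)"
  have n1: "(\<lambda>t. norm (F' t)) integrable_on {a..b}"
    by (intro integrable_continuous_interval continuous_intros cont)
  have n2: "(\<lambda>t. (norm (F' t))\<^sup>2) integrable_on {a..b}"
    by (intro integrable_continuous_interval continuous_intros cont)
  have I0: "I \<ge> 0" unfolding I_def by (rule integral_nonneg[OF n2]) auto
  have N0: "N \<ge> 0" unfolding N_def by (rule integral_nonneg[OF n1]) auto
  have "F b - F a = integral {a..b} F'"
    using fundamental_theorem_of_calculus[OF ab der] by (simp add: integral_unique)
  hence FN: "norm (F b - F a) \<le> N"
    unfolding N_def using integral_norm_bound_integral[OF _ n1] integrable_continuous_interval[OF cont] by force
  define c where "c = N / (b - a)"
  have c: "c * (b - a) = N" using ab' by (simp add: c_def)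
  \<comment> \<open>Cauchy-Schwarz arises from integrating the square of the deviation of the speed from its mean \<open>c\<close>.\<close>
  have "((\<lambda>t. (c - norm (F' t))\<^sup>2) has_integral c\<^sup>2 * (b - a) - 2 * c * N + I) {a..b}"
  proof -
    have "((\<lambda>t. c\<^sup>2 - 2 * c * norm (F' t) + (norm (F' t))\<^sup>2) has_integral (b - a) *\<^sub>R c\<^sup>2 - 2 * c * N + I) {a..b}"
      using ab n1 n2 unfolding N_def I_def
      by (intro has_integral_add has_integral_diff has_integral_mult_right integrable_integral)
         (auto intro: has_integral_const_real[THEN has_integral_eq_rhs])
    thus ?thesis by (simp add: power2_diff algebra_simps)
  qed
  hence "0 \<le> c\<^sup>2 * (b - a) - 2 * c * N + I"
    by (rule has_integral_nonneg) auto
  hence "0 \<le> (c\<^sup>2 * (b - a) - 2 * c * N + I) * (b - a)"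
    using ab' by (intro mult_nonneg_nonneg) auto
  also have "\<dots> = (c * (b - a))\<^sup>2 - 2 * (c * (b - a)) * N + (b - a) * I"
    by (simp add: algebra_simps power2_eq_square)
  finally have NI: "N\<^sup>2 \<le> (b - a) * I"
    unfolding c by (simp add: power2_eq_square)
  have "((\<lambda>t. indicator {a..b} t *\<^sub>R (norm (F' t))\<^sup>2) has_integral I) UNIV"
  proof -
    have "(\<lambda>t. indicator {a..b} t *\<^sub>R (norm (F' t))\<^sup>2) = (\<lambda>t. if t \<in> {a..b} then (norm (F' t))\<^sup>2 else 0)"
      by (auto simp: indicator_def)
    thus ?thesis
      using n2 has_integral_restrict_UNIV[of "{a..b}" "\<lambda>t. (norm (F' t))\<^sup>2" I]
      by (simp only: I_def integrable_integral)
  qed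
  moreover have "(\<lambda>t. indicator {a..b} t *\<^sub>R (norm (F' t))\<^sup>2) \<in> borel_measurable borel"
    by (intro borel_measurable_continuous_on_indicator continuous_intros cont) auto
  ultimately have "(\<integral>\<^sup>+ t. ennreal (indicator {a..b} t *\<^sub>R (norm (F' t))\<^sup>2) \<partial>lborel) = ennreal I"
    by (subst nn_integral_has_integral_lborel[of _ I]) auto
  also have "(\<integral>\<^sup>+ t. ennreal (indicator {a..b} t *\<^sub>R (norm (F' t))\<^sup>2) \<partial>lborel) =
      (\<integral>\<^sup>+ t. indicator {a..b} t * ennreal ((norm (F' t))\<^sup>2) \<partial>lborel)"
    by (intro nn_integral_cong) (auto simp: indicator_def)
  finally have "ennreal I \<le> ennreal J" using E by simp
  hence "I \<le> J" using J I0 by simp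
  hence "(b - a) * I \<le> (b - a) * J" using ab by (intro mult_left_mono) auto
  moreover have "(norm (F b - F a))\<^sup>2 \<le> N\<^sup>2" using FN by (intro power_mono) auto
  ultimately show ?thesis using NI by linarith
qed auto

lemma horizontal_chord:
  assumes S: "open S" and G: "G holomorphic_on S" and J: "0 \<le> J"
    and E: "(\<integral>\<^sup>+ x. energy_density S G x y \<partial>lborel) \<le> ennreal J"
    and ab: "a \<le> b" and seg: "\<And>x. x \<in> {a..b} \<Longrightarrow> Complex x y \<in> S"
  shows "(norm (G (Complex b y) - G (Complex a y)))\<^sup>2 \<le> (b - a) * J"
proof (rule chord_energy_bound[OF ab _ _ J])
  fix t assume t: "t \<in> {a..b}"
  have "((\<lambda>t. Complex t y) has_vector_derivative 1) (at t within {a..b})"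
    unfolding Complex_eq by (auto intro!: derivative_eq_intros)
  from field_vector_diff_chain_within[OF this, of G "deriv G (Complex t y)"]
  show "((\<lambda>t. G (Complex t y)) has_vector_derivative deriv G (Complex t y)) (at t within {a..b})"
    using holomorphic_derivI[OF G S seg[OF t]] by (simp add: o_def has_field_derivative_at_within)
next
  show "continuous_on {a..b} (\<lambda>t. deriv G (Complex t y))"
    unfolding Complex_eq
    by (intro continuous_on_compose2[OF holomorphic_on_imp_continuous_on[OF holomorphic_deriv[OF G S]]] continuous_intros)
       (use seg in \<open>auto simp: Complex_eq\<close>)
  show "(\<integral>\<^sup>+ t. indicator {a..b} t * ennreal ((norm (deriv G (Complex t y)))\<^sup>2) \<partial>lborel) \<le> ennreal J"
    by (rule order.trans[OF nn_integral_mono E]) (auto simp: energy_density_def indicator_def seg)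
qed

lemma vertical_chord:
  assumes S: "open S" and G: "G holomorphic_on S" and J: "0 \<le> J"
    and E: "(\<integral>\<^sup>+ y. energy_density S G x y \<partial>lborel) \<le> ennreal J"
    and ab: "a \<le> b" and seg: "\<And>y. y \<in> {a..b} \<Longrightarrow> Complex x y \<in> S"
  shows "(norm (G (Complex x b) - G (Complex x a)))\<^sup>2 \<le> (b - a) * J"
proof (rule chord_energy_bound[OF ab _ _ J])
  fix t assume t: "t \<in> {a..b}"
  have "((\<lambda>t. Complex x t) has_vector_derivative \<i>) (at t within {a..b})"
    unfolding Complex_eq by (auto intro!: derivative_eq_intros)
  from field_vector_diff_chain_within[OF this, of G "deriv G (Complex x t)"]
  show "((\<lambda>t. G (Complex x t)) has_vector_derivative \<i> * deriv G (Complex x t)) (at t within {a..b})"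
    using holomorphic_derivI[OF G S seg[OF t]] by (simp add: o_def has_field_derivative_at_within)
next
  show "continuous_on {a..b} (\<lambda>t. \<i> * deriv G (Complex x t))"
    unfolding Complex_eq
    by (intro continuous_intros continuous_on_compose2[OF holomorphic_on_imp_continuous_on[OF holomorphic_deriv[OF G S]]])
       (use seg in \<open>auto simp: Complex_eq\<close>)
  show "(\<integral>\<^sup>+ t. indicator {a..b} t * ennreal ((norm (\<i> * deriv G (Complex x t)))\<^sup>2) \<partial>lborel) \<le> ennreal J"
    by (rule order.trans[OF nn_integral_mono E]) (auto simp: energy_density_def indicator_def seg norm_mult)
qed

text \<open>
  By Tonelli the finite total energy is the integral of the energies of the horizontal lines, so almost
  all of these are finite.
\<close>
lemma almost_every_horizontal_finite_energy:
  assumes S: "open S" and G: "G holomorphic_on S" "inj_on G S" and b: "bounded (G ` S)"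
    and cd: "c < d"
  shows "\<exists>y\<in>{c<..<d}. (\<integral>\<^sup>+ x. energy_density S G x y \<partial>lborel) < \<infinity>"
proof -
  have m: "(\<lambda>p. energy_density S G (fst p) (snd p)) \<in> borel_measurable (lborel \<Otimes>\<^sub>M lborel)"
    using measurable_energy_density[OF S G(1)] by (simp add: lborel_prod)
  have "(\<integral>\<^sup>+ y. (\<integral>\<^sup>+ x. energy_density S G x y \<partial>lborel) \<partial>lborel) = 
        (\<integral>\<^sup>+ p. energy_density S G (fst p) (snd p) \<partial>(lborel \<Otimes>\<^sub>M lborel))"
    by (subst lborel_pair.nn_integral_snd[OF m, symmetric]) simp
  also have "\<dots> < \<infinity>" using finite_energy[OF S G b] by (simp add: lborel_prod)
  finally have fin: "(\<integral>\<^sup>+ y. (\<integral>\<^sup>+ x. energy_density S G x y \<partial>lborel) \<partial>lborel) \<noteq> \<infinity>" by simp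
  have m2: "(\<lambda>y. \<integral>\<^sup>+ x. energy_density S G x y \<partial>lborel) \<in> borel_measurable lborel"
    using lborel.borel_measurable_nn_integral_fst[OF measurable_pair_swap[OF m]] by simp
  have ae: "AE y in lborel. (\<integral>\<^sup>+ x. energy_density S G x y \<partial>lborel) \<noteq> \<infinity>"
    by (rule nn_integral_PInf_AE[OF m2 fin])
  show ?thesis
  proof (rule ccontr)
    assume "\<not> ?thesis"
    hence "AE y in lborel. y \<notin> {c<..<d}" using ae by (elim eventually_mono) (auto simp: less_top)
    hence "{c<..<d} \<in> null_sets lborel" by (subst (asm) AE_iff_null_sets[symmetric]) auto
    thus False using cd by (auto simp: null_sets_def)
  qed
qed

text \<open>
  The length-area estimate in logarithmic polar coordinates, where vertical segments stand for circular arcs.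
  The segments of energy at least \<open>\<delta>\<close> have abscissas in a set of finite measure, so far to the left this set
  cannot contain an interval of length \<open>\<eta>\<close>; and a segment of energy less than \<open>\<delta>\<close> has an image of
  diameter less than \<open>\<epsilon>\<close>.
\<close>
lemma small_vertical_oscillation:
  assumes cd: "c < d" and S: "S = {z. Re z < b \<and> c < Im z \<and> Im z < d}"
    and G: "G holomorphic_on S" "inj_on G S" and bd: "bounded (G ` S)"
    and e: "\<epsilon> > 0" "\<eta> > 0"
  shows "\<forall>\<^sub>F x in at_bot. \<exists>u\<in>{x-\<eta>..x}. \<forall>y\<in>{c<..<d}. \<forall>y'\<in>{c<..<d}. norm (G (Complex u y) - G (Complex u y')) < \<epsilon>"
proof -
  have oS: "open S" unfolding S
    by (intro open_Collect_conj open_halfspace_Re_lt open_halfspace_Im_gt open_halfspace_Im_lt)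
  define J where "J x = (\<integral>\<^sup>+ y. energy_density S G x y \<partial>lborel)" for x
  have m: "(\<lambda>p. energy_density S G (fst p) (snd p)) \<in> borel_measurable (lborel \<Otimes>\<^sub>M lborel)"
    using measurable_energy_density[OF oS G(1)] by (simp add: lborel_prod)
  have mJ [measurable]: "J \<in> borel_measurable lborel"
    unfolding J_def using lborel.borel_measurable_nn_integral_fst[OF m] by simp
  have "(\<integral>\<^sup>+ x. J x \<partial>lborel) = (\<integral>\<^sup>+ p. energy_density S G (fst p) (snd p) \<partial>(lborel \<Otimes>\<^sub>M lborel))"
    unfolding J_def by (subst lborel.nn_integral_fst[OF m, symmetric]) simp
  also have "\<dots> < \<infinity>" using finite_energy[OF oS G bd] by (simp add: lborel_prod)
  finally have fin: "(\<integral>\<^sup>+ x. J x \<partial>lborel) < \<infinity>" .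
  define \<delta> where "\<delta> = \<epsilon>\<^sup>2 / (2 * (d - c))"
  have \<delta>: "\<delta> > 0" unfolding \<delta>_def using e cd by auto
  define K where "K = {x. ennreal \<delta> \<le> J x}"
  have K [measurable]: "K \<in> sets lborel" unfolding K_def by measurable
  \<comment> \<open>Markov's inequality bounds the set of bad abscissas.\<close>
  have "emeasure lborel K \<le> ennreal (1 / \<delta>) * (\<integral>\<^sup>+ x. J x * indicator UNIV x \<partial>lborel)"
  proof -
    have "1 \<le> ennreal (1 / \<delta>) * J x" if "x \<in> K" for x
    proof -
      have "1 = ennreal (1 / \<delta>) * ennreal \<delta>" using \<delta> by (simp flip: ennreal_mult)
      also have "\<dots> \<le> ennreal (1 / \<delta>) * J x" using that by (intro mult_left_mono) (auto simp: K_def)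
      finally show ?thesis .
    qed
    hence "emeasure lborel K \<le> emeasure lborel {x \<in> UNIV. 1 \<le> ennreal (1 / \<delta>) * J x}"
      by (intro emeasure_mono) auto
    thus ?thesis using nn_integral_Markov_inequality[of J UNIV lborel "ennreal (1 / \<delta>)"] by force
  qed
  also have "\<dots> < \<infinity>" using fin by (simp add: ennreal_mult_less_top)
  finally have Kfin: "emeasure lborel K < \<infinity>" .
  have "(\<lambda>n::nat. emeasure lborel (K \<inter> {..- real n})) \<longlonglongrightarrow> emeasure lborel (\<Inter>n. K \<inter> {..- real n})"
  proof (rule Lim_emeasure_decseq)
    show "decseq (\<lambda>n. K \<inter> {..- real n})" by (auto simp: decseq_def)
    show "emeasure lborel (K \<inter> {..- real n}) \<noteq> \<infinity>" for n
      using Kfin emeasure_mono[of "K \<inter> {..- real n}" K lborel] K by auto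
  qed auto
  also have "(\<Inter>n. K \<inter> {..- real n}) = {}"
  proof -
    have "\<exists>n. - real n < x" for x :: real
      using reals_Archimedean2[of "-x"] by (simp add: minus_less_iff)
    hence "x \<notin> (\<Inter>n. K \<inter> {..- real n})" for x
      by (metis INT_iff IntD2 UNIV_I atMost_iff not_le)
    thus ?thesis by blast
  qed
  finally have "(\<lambda>n::nat. emeasure lborel (K \<inter> {..- real n})) \<longlonglongrightarrow> 0" by simp
  hence "\<forall>\<^sub>F n in sequentially. emeasure lborel (K \<inter> {..- real n}) < ennreal \<eta>"
    by (rule order_tendstoD) (use e in auto)
  then obtain n where n: "emeasure lborel (K \<inter> {..- real n}) < ennreal \<eta>"
    by (auto simp: eventually_sequentially)
  show ?thesis
  proof (rule eventually_at_bot_linorderI[of "min (- real n) (b - 1)"])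
    fix x assume x: "x \<le> min (- real n) (b - 1)"
    have "\<not> {x-\<eta>..x} \<subseteq> K"
    proof
      assume "{x-\<eta>..x} \<subseteq> K"
      hence "{x-\<eta>..x} \<subseteq> K \<inter> {..- real n}" using x by auto
      hence "emeasure lborel {x-\<eta>..x} \<le> emeasure lborel (K \<inter> {..- real n})"
        by (intro emeasure_mono) auto
      thus False using n e by simp
    qed
    then obtain u where u: "u \<in> {x-\<eta>..x}" "u \<notin> K" by blast
    hence Ju: "J u < ennreal \<delta>" by (simp add: K_def not_le)
    have *: "norm (G (Complex u y') - G (Complex u y)) < \<epsilon>" if "y \<le> y'" "c < y" "y' < d" for y y'
    proof -
      have "(norm (G (Complex u y') - G (Complex u y)))\<^sup>2 \<le> (y' - y) * \<delta>"
        using u Ju[unfolded J_def] that x \<delta>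
        by (intro vertical_chord[OF oS G(1)]) (auto simp: S intro: less_imp_le)
      also have "\<dots> \<le> (d - c) * \<delta>" using that \<delta> by (intro mult_right_mono) auto
      also have "\<dots> < \<epsilon>\<^sup>2" unfolding \<delta>_def using e cd by (simp add: field_simps)
      finally show ?thesis using e by (simp add: power2_less_imp_less)
    qed
    have "norm (G (Complex u y) - G (Complex u y')) < \<epsilon>" if "y \<in> {c<..<d}" "y' \<in> {c<..<d}" for y y'
      using *[of y y'] *[of y' y] that by (cases "y \<le> y'") (auto simp: norm_minus_commute)
    thus "\<exists>u\<in>{x-\<eta>..x}. \<forall>y\<in>{c<..<d}. \<forall>y'\<in>{c<..<d}. norm (G (Complex u y) - G (Complex u y')) < \<epsilon>"
      using u by blast
  qed
qed

text \<open>
  Finite energy makes the restriction to the line Hoelder continuous with exponent \<open>1/2\<close>, so it extends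
  continuously to the end point.
\<close>
lemma finite_energy_imp_limit:
  assumes S: "open S" and G: "G holomorphic_on S" and ab: "a < b"
    and E: "(\<integral>\<^sup>+ x. energy_density S G x y \<partial>lborel) < \<infinity>"
    and seg: "\<And>x. a < x \<Longrightarrow> x < b \<Longrightarrow> Complex x y \<in> S"
  shows "\<exists>p. ((\<lambda>x. G (Complex x y)) \<longlongrightarrow> p) (at_left b)"
proof -
  obtain J where J: "0 \<le> J" "(\<integral>\<^sup>+ x. energy_density S G x y \<partial>lborel) = ennreal J"
    using E by (metis ennreal_cases infinity_ennreal_def order_less_irrefl)
  have bound: "(norm (G (Complex x y) - G (Complex x' y)))\<^sup>2 \<le> \<bar>x - x'\<bar> * J" if "a < x" "x < b" "a < x'" "x' < b" for x x'
    using horizontal_chord[OF S G J(1), of y x x'] horizontal_chord[OF S G J(1), of y x' x] J(2) that seg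
    by (cases "x \<le> x'") (auto simp: norm_minus_commute)
  have uc: "uniformly_continuous_on {a<..<b} (\<lambda>x. G (Complex x y))"
    unfolding uniformly_continuous_on_def
  proof (intro allI impI)
    fix e :: real assume e: "e > 0"
    show "\<exists>d>0. \<forall>x\<in>{a<..<b}. \<forall>x'\<in>{a<..<b}. dist x' x < d \<longrightarrow> dist (G (Complex x' y)) (G (Complex x y)) < e"
    proof (intro exI[of _ "e\<^sup>2 / (J + 1)"] conjI ballI impI)
      show "0 < e\<^sup>2 / (J + 1)" using e J(1) by simp
      fix x x' assume x: "x \<in> {a<..<b}" "x' \<in> {a<..<b}" "dist x' x < e\<^sup>2 / (J + 1)"
      have "(norm (G (Complex x' y) - G (Complex x y)))\<^sup>2 \<le> \<bar>x' - x\<bar> * J" using x by (intro bound) auto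
      also have "\<dots> \<le> \<bar>x' - x\<bar> * (J + 1)" by (intro mult_left_mono) auto
      also have "\<dots> < e\<^sup>2" using x(3) J(1) by (simp add: dist_real_def pos_less_divide_eq)
      finally show "dist (G (Complex x' y)) (G (Complex x y)) < e"
        using e by (simp add: dist_norm power2_less_imp_less)
    qed
  qed
  have "b \<in> closure {a<..<b}" using ab by simp
  then obtain p where p: "((\<lambda>x. G (Complex x y)) \<longlongrightarrow> p) (at b within {a<..<b})"
    using uniformly_continuous_on_extension_at_closure[OF uc] by metis
  moreover have "at b within {a<..<b} = at_left b"
    using ab by (intro at_within_nhd[of b "{a<..}"]) auto
  ultimately show ?thesis by auto
qed

section \<open>Existence of the exterior map\<close>

text \<open>
  Inversion turns the complement of \<open>X\<close> in the sphere into a plane region \<open>\<Omega>\<close> containing \<open>0\<close>. It is simply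
  connected because its complement, the inverted \<open>X - {0}\<close>, has no bounded component: by the Sura-Bura theorem
  a bounded component would lie in a compact relatively open part of the complement, whose inverse would be
  open and closed in the connected set \<open>X\<close> without containing \<open>0\<close>.
\<close>
lemma complement_of_inverted_continuum:
  fixes X :: "complex set"
  assumes comp: "compact X" and con: "connected X" and con': "connected (- X)" and zero: "0 \<in> X"
  defines "\<Omega> \<equiv> {z. z = 0 \<or> inverse z \<notin> X}"
  shows "open \<Omega>" "simply_connected \<Omega>"
proof -
  obtain B where B: "B > 0" "\<And>x. x \<in> X \<Longrightarrow> norm x \<le> B"
    using compact_imp_bounded[OF comp] unfolding bounded_pos by blast
  define K where "K = - \<Omega>"
  have K: "K = {z. z \<noteq> 0 \<and> inverse z \<in> X}" by (auto simp: K_def \<Omega>_def)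
  have "K = {z. 1 / B \<le> norm z} \<inter> inverse -` X"
  proof -
    have "1 / B \<le> norm z" if "z \<noteq> 0" "inverse z \<in> X" for z
      using B(2)[OF that(2)] B(1) that(1) by (simp add: norm_inverse norm_divide field_simps)
    moreover have "z \<noteq> 0" if "1 / B \<le> norm z" for z :: complex
      using that B(1) by auto
    ultimately show ?thesis unfolding K by auto
  qed
  moreover have "closed ({z. 1 / B \<le> norm z} \<inter> inverse -` X)"
  proof (rule continuous_closed_preimage)
    show "continuous_on {z. 1 / B \<le> norm z} (inverse :: complex \<Rightarrow> complex)"
      using B(1) by (intro continuous_intros) auto
    show "closed {z::complex. 1 / B \<le> norm z}" by (intro closed_Collect_le continuous_intros)
  qed (use comp compact_imp_closed in blast)
  ultimately have clK: "closed K" by simp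
  thus op: "open \<Omega>" unfolding K_def by (simp add: open_closed)
  have "connected (inverse ` (- X))"
    using zero by (intro connected_continuous_image con' continuous_intros) auto
  moreover have "inverse ` (- X) \<subseteq> \<Omega>"
    using zero by (auto simp: \<Omega>_def)
  moreover have "\<Omega> \<subseteq> closure (inverse ` (- X))"
  proof
    fix z assume z: "z \<in> \<Omega>"
    show "z \<in> closure (inverse ` (- X))"
    proof (cases "z = 0")
      case False
      with z have "z \<in> inverse ` (- X)"
        by (intro image_eqI[of _ _ "inverse z"]) (auto simp: \<Omega>_def)
      thus ?thesis by (rule closure_subset[THEN subsetD])
    next
      case True
      show ?thesis unfolding True closure_approachable
      proof (intro allI impI)
        fix e :: real assume e: "e > 0"
        define w where "w = complex_of_real (max (B + 1) (2 / e))"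
        have nw: "norm w = max (B + 1) (2 / e)" using B(1) by (simp add: w_def)
        hence "w \<in> - X" using B(2)[of w] by auto
        moreover have "dist (inverse w) 0 < e"
        proof -
          have "2 / e \<le> norm w" using nw by simp
          hence "inverse (norm w) \<le> inverse (2 / e)" using e by (intro le_imp_inverse_le) auto
          also have "\<dots> < e" using e by simp
          finally show ?thesis by (simp add: norm_inverse)
        qed
        ultimately show "\<exists>y\<in>inverse ` (- X). dist y 0 < e" by blast
      qed
    qed
  qed
  ultimately have con\<Omega>: "connected \<Omega>" by (rule connected_intermediate_closure)
  have "\<not> bounded C" if C: "C \<in> components K" for C
  proof
    assume "bounded C"
    hence "compact C" using closed_components[OF clK C] by (simp add: compact_eq_bounded_closed)
    then obtain T where T: "openin (top_of_set K) T" "compact T" "C \<subseteq> T"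
      using Sura_Bura_clopen_subset[OF closed_imp_locally_compact[OF clK] C, of UNIV] by auto
    obtain V where V: "open V" "T = K \<inter> V" using T(1) by (auto simp: openin_open)
    have T0: "0 \<notin> T" using V(2) K by auto
    have "compact (inverse ` T)"
      using T0 T(2) by (intro compact_continuous_image continuous_intros) auto
    moreover have sub: "inverse ` T \<subseteq> X - {0}" using V(2) K by auto
    ultimately have "closedin (top_of_set X) (inverse ` T)"
      by (intro closed_subset compact_imp_closed) auto
    moreover have "openin (top_of_set X) (inverse ` T)"
    proof -
      have "open ((- {0}) \<inter> inverse -` V)"
        using V(1) by (intro continuous_open_preimage continuous_intros) auto
      moreover have "inverse ` T = X \<inter> ((- {0}) \<inter> inverse -` V)"
      proof -
        have "x \<in> inverse ` T" if "x \<in> X" "x \<noteq> 0" "inverse x \<in> V" for x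
          using that V(2) K by (intro image_eqI[of _ _ "inverse x"]) auto
        thus ?thesis using V(2) K by auto
      qed
      ultimately show ?thesis by (auto simp: openin_open)
    qed
    ultimately have "inverse ` T = {} \<or> inverse ` T = X"
      using con connected_clopen by blast
    hence "T = {}" using sub zero by blast
    thus False using T(3) in_components_nonempty[OF C] by blast
  qed
  thus "simply_connected \<Omega>"
    using simply_connected_eq_unbounded_complement_components[OF op] con\<Omega> by (simp add: K_def)
qed

text \<open>
  A disk automorphism moves the preimage of \<open>0\<close> to the centre, a rotation makes the derivative positive.
\<close>
lemma ex_normalised_Riemann_map:
  fixes \<Omega> :: "complex set"
  assumes "open \<Omega>" "simply_connected \<Omega>" "0 \<in> \<Omega>" "\<Omega> \<noteq> UNIV"
  shows "\<exists>f. f holomorphic_on ball 0 1 \<and> bij_betw f (ball 0 1) \<Omega> \<and> f 0 = 0 \<and>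
           (\<exists>c::real. c > 0 \<and> (f has_field_derivative of_real c) (at 0))"
proof -
  obtain f g where f: "f holomorphic_on \<Omega>" and g: "g holomorphic_on ball 0 1"
    and fg: "\<And>z. z \<in> \<Omega> \<Longrightarrow> f z \<in> ball 0 1 \<and> g (f z) = z"
    and gf: "\<And>z. z \<in> ball 0 1 \<Longrightarrow> g z \<in> \<Omega> \<and> f (g z) = z"
    using Riemann_mapping_theorem[of \<Omega>] assms by blast
  have f0: "f 0 \<in> ball 0 1" using fg[OF assms(3)] by blast
  obtain m n where mn0: "m (f 0) = 0" "m holomorphic_on ball 0 1" "m ` ball 0 1 \<subseteq> ball 0 1"
      "n holomorphic_on ball 0 1" "n ` ball 0 1 \<subseteq> ball 0 1"
    and mn: "\<And>z. z \<in> ball 0 1 \<Longrightarrow> m (n z) = z" "\<And>z. z \<in> ball 0 1 \<Longrightarrow> n (m z) = z"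
    using ball_biholomorphism_exists[OF f0] by blast
  have m: "m (f 0) = 0" "m holomorphic_on ball 0 1" "\<And>z. z \<in> ball 0 1 \<Longrightarrow> m z \<in> ball 0 1"
    and n: "n holomorphic_on ball 0 1" "\<And>z. z \<in> ball 0 1 \<Longrightarrow> n z \<in> ball 0 1"
    using mn0 by blast+
  define h where "h = g \<circ> n"
  have h: "h holomorphic_on ball 0 1" unfolding h_def
    by (rule holomorphic_on_compose_gen[OF n(1) g]) (use n(2) in auto)
  have h0: "h 0 = 0"
    using mn(2)[of "f 0"] m(1) fg[OF assms(3)] by (simp add: h_def)
  have injh: "inj_on h (ball 0 1)"
    by (rule inj_on_inverseI[of _ "m \<circ> f"]) (use gf n(2) mn in \<open>simp add: h_def del: mem_ball\<close>)
  have imh: "h ` ball 0 1 = \<Omega>"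
  proof
    show "h ` ball 0 1 \<subseteq> \<Omega>" using gf n(2) by (auto simp: h_def simp del: mem_ball)
    show "\<Omega> \<subseteq> h ` ball 0 1"
    proof
      fix z assume z: "z \<in> \<Omega>"
      show "z \<in> h ` ball 0 1"
        by (rule image_eqI[of _ _ "m (f z)"]) (use z fg m(3) mn in \<open>auto simp: h_def simp del: mem_ball\<close>)
    qed
  qed
  define d where "d = deriv h 0"
  have d: "d \<noteq> 0" unfolding d_def
    by (rule holomorphic_injective_imp_regular[OF h _ injh]) auto
  define u where "u = cnj (sgn d)"
  have u: "norm u = 1" "u * d = of_real (norm d)"
  proof -
    show "norm u = 1" using d by (simp add: u_def norm_sgn)
    have "cnj d * d = of_real (norm d) * of_real (norm d)"
      using complex_norm_square[of d] by (simp add: power2_eq_square mult.commute)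
    thus "u * d = of_real (norm d)" using d
      by (simp add: u_def sgn_div_norm scaleR_conv_of_real field_simps)
  qed
  have rot: "(\<lambda>z. u * z) ` ball 0 1 = ball 0 1"
  proof -
    have "z \<in> (\<lambda>z. u * z) ` ball 0 1" if "norm z < 1" for z
      using that u(1) by (intro image_eqI[of _ _ "z / u"]) (auto simp: norm_divide)
    thus ?thesis using u(1) by (auto simp: norm_mult)
  qed
  show ?thesis
  proof (intro exI[of _ "\<lambda>z. h (u * z)"] conjI exI[of _ "norm d"])
    show "(\<lambda>z. h (u * z)) holomorphic_on ball 0 1"
      by (rule holomorphic_on_compose_gen[OF _ h, unfolded o_def]) (use rot in \<open>auto intro!: holomorphic_intros\<close>)
    have "inj_on (\<lambda>z. u * z) (ball 0 1)" using u(1) by (auto intro!: inj_onI)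
    hence "bij_betw (h \<circ> (\<lambda>z. u * z)) (ball 0 1) \<Omega>"
      using injh imh rot by (intro bij_betw_trans[of _ _ "ball 0 1"]) (auto simp: bij_betw_def simp del: mem_ball)
    thus "bij_betw (\<lambda>z. h (u * z)) (ball 0 1) \<Omega>" by (simp add: o_def)
    have "(h has_field_derivative d) (at (u * 0))"
      using holomorphic_derivI[OF h, of 0] by (simp add: d_def)
    hence "((\<lambda>z. h (u * z)) has_field_derivative d * u) (at 0)"
      by (rule DERIV_chain2) (auto intro!: derivative_eq_intros)
    thus "((\<lambda>z. h (u * z)) has_field_derivative of_real (norm d)) (at 0)"
      using u(2) by (simp add: mult.commute)
  qed (use h0 d in auto)
qed

text \<open>
  The exterior map is the reciprocal of the normalised Riemann map of the inverted complement.
\<close>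
lemma ex_exterior_conformal_iso:
  fixes X :: "complex set"
  assumes comp: "compact X" and con: "connected X" and con': "connected (- X)" and zero: "0 \<in> X"
    and a: "a \<in> X" "a \<noteq> 0"
  shows "\<exists>\<phi>. exterior_conformal_iso X \<phi>"
proof -
  define \<Omega> where "\<Omega> = {z. z = 0 \<or> inverse z \<notin> X}"
  have "open \<Omega>" "simply_connected \<Omega>"
    using complement_of_inverted_continuum[OF comp con con' zero] by (simp_all add: \<Omega>_def)
  moreover have "0 \<in> \<Omega>" "inverse a \<notin> \<Omega>" using a by (auto simp: \<Omega>_def)
  ultimately obtain f c where f: "f holomorphic_on ball 0 1" "bij_betw f (ball 0 1) \<Omega>" "f 0 = 0"
    and c: "c > 0" "(f has_field_derivative complex_of_real c) (at 0)"
    using ex_normalised_Riemann_map[of \<Omega>] by blast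
  have inj: "inj_on f (ball 0 1)" using f(2) by (simp add: bij_betw_def)
  have f0: "f z \<noteq> 0" if "z \<in> ball 0 1 - {0}" for z
    using inj_onD[OF inj, of z 0] that f(3) by auto
  have holo: "(\<lambda>z. inverse (f z)) holomorphic_on (ball 0 1 - {0})"
    using f0 by (intro holomorphic_intros holomorphic_on_subset[OF f(1)]) auto
  have lim: "((\<lambda>z. z * inverse (f z)) \<longlongrightarrow> of_real (inverse c)) (at 0)"
  proof -
    have "((\<lambda>z. f z / z) \<longlongrightarrow> of_real c) (at 0)"
      using c(2) f(3) by (simp add: has_field_derivative_iff)
    from tendsto_inverse[OF this] c(1) show ?thesis by (simp add: field_simps)
  qed
  have "is_pole (\<lambda>z. inverse (f z)) 0"
    unfolding is_pole_def
  proof (rule filterlim_compose[OF filterlim_inverse_at_infinity])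
    have "isCont f 0" using c(2) DERIV_isCont by blast
    hence "(f \<longlongrightarrow> 0) (at 0)" using f(3) by (simp add: isCont_def)
    moreover have "\<forall>\<^sub>F z in at 0. f z \<noteq> 0"
      using eventually_at_in_open[of "ball 0 1" "0::complex"] f0 by (auto elim!: eventually_mono)
    ultimately show "filterlim f (at 0) (at 0)" by (simp add: filterlim_at)
  qed
  moreover have "bij_betw (\<lambda>z. inverse (f z)) (ball 0 1 - {0}) (- X)"
  proof -
    have "bij_betw f (ball 0 1 - {0}) (\<Omega> - {0})"
      using bij_betw_DiffI[OF f(2), of "{0}" "{0}"] f(3) \<open>0 \<in> \<Omega>\<close> by simp
    moreover have "bij_betw inverse (\<Omega> - {0}) (- X)"
    proof (rule bij_betwI')
      show "inverse x \<in> - X" if "x \<in> \<Omega> - {0}" for x using that by (auto simp: \<Omega>_def)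
      show "\<exists>x\<in>\<Omega> - {0}. y = inverse x" if "y \<in> - X" for y
        using that zero by (intro bexI[of _ "inverse y"]) (auto simp: \<Omega>_def)
    qed auto
    ultimately have "bij_betw (inverse \<circ> f) (ball 0 1 - {0}) (- X)" by (rule bij_betw_trans)
    thus ?thesis by (simp add: o_def)
  qed
  ultimately have "exterior_conformal_iso X (\<lambda>z. inverse (f z))"
    unfolding exterior_conformal_iso_def using holo lim c(1)
    by (intro conjI exI[of _ "inverse c"]) auto
  thus ?thesis by blast
qed

section \<open>The exterior map and its lift through the exponential\<close>

locale exterior_map =
  fixes X :: "complex set" and \<phi> :: "complex \<Rightarrow> complex"
  assumes iso: "exterior_conformal_iso X \<phi>" and comp: "compact X" and zero: "0 \<in> X"
begin

lemma holo: "\<phi> holomorphic_on (ball 0 1 - {0})"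
  and pole: "is_pole \<phi> 0"
  and bij: "bij_betw \<phi> (ball 0 1 - {0}) (- X)"
  using iso by (auto simp: exterior_conformal_iso_def)

lemma inj: "inj_on \<phi> (ball 0 1 - {0})"
  using bij by (auto simp: bij_betw_def)

lemma in_exterior: "z \<noteq> 0 \<Longrightarrow> norm z < 1 \<Longrightarrow> \<phi> z \<in> - X"
  using bij by (auto simp: bij_betw_def)

lemma nonzero: "z \<noteq> 0 \<Longrightarrow> norm z < 1 \<Longrightarrow> \<phi> z \<noteq> 0"
  using in_exterior[of z] zero by auto

text \<open>
  The pole at \<open>0\<close> is simple with a non-zero coefficient and \<open>\<phi>\<close> omits \<open>0\<close>, so \<open>z * \<phi> z\<close> extends to a function
  without zeros on the disk, which has a logarithm.
\<close>
lemma ex_log_factor: "\<exists>k. k holomorphic_on ball 0 1 \<and> (\<forall>z\<in>ball 0 1 - {0}. z * \<phi> z = exp (k z))"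
proof -
  obtain c :: real where c: "c > 0" "((\<lambda>z. z * \<phi> z) \<longlongrightarrow> complex_of_real c) (at 0)"
    using iso by (auto simp: exterior_conformal_iso_def)
  define h where "h z = (if z = 0 then of_real c else z * \<phi> z)" for z
  have "h holomorphic_on ball 0 1" unfolding h_def
    by (rule removable_singularity) (use c holo in \<open>auto intro!: holomorphic_intros\<close>)
  moreover have "h z \<noteq> 0" if "z \<in> ball 0 1" for z
    using nonzero[of z] that c by (auto simp: h_def)
  ultimately obtain k where "k holomorphic_on ball 0 1" "\<And>z. z \<in> ball 0 1 \<Longrightarrow> h z = exp (k z)"
    using simply_connected_eq_holomorphic_log[of "ball 0 1"] convex_imp_simply_connected[of "ball 0 1 :: complex set"]
    by (auto simp del: mem_ball)
  thus ?thesis by (intro exI[of _ k]) (auto simp: h_def, metis)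
qed

definition log_factor :: "complex \<Rightarrow> complex" where
  "log_factor = (SOME k. k holomorphic_on ball 0 1 \<and> (\<forall>z\<in>ball 0 1 - {0}. z * \<phi> z = exp (k z)))"

lemma log_factor_holo: "log_factor holomorphic_on ball 0 1"
  and log_factor: "z \<noteq> 0 \<Longrightarrow> norm z < 1 \<Longrightarrow> z * \<phi> z = exp (log_factor z)"
  using someI_ex[OF ex_log_factor, folded log_factor_def] by auto

text \<open>
  The injective function \<open>1 / \<phi>\<close> maps a neighbourhood of \<open>0\<close> onto a neighbourhood of \<open>0\<close>, so that elsewhere
  it stays away from \<open>0\<close>.
\<close>
lemma bounded_near_circle:
  assumes "0 < \<rho>" "\<rho> < 1"
  shows "\<exists>C>0. \<forall>z. \<rho> \<le> norm z \<longrightarrow> norm z < 1 \<longrightarrow> norm (\<phi> z) \<le> C"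
proof -
  define f where "f z = z * exp (- log_factor z)" for z
  have f: "f holomorphic_on ball 0 1"
    unfolding f_def by (intro holomorphic_intros log_factor_holo)
  have f\<phi>: "f z * \<phi> z = 1" if "z \<noteq> 0" "norm z < 1" for z
    using log_factor[OF that] that by (simp add: f_def exp_minus field_simps)
  have injf: "inj_on f (ball 0 1)"
  proof (rule inj_onI)
    fix x y assume xy: "x \<in> ball 0 1" "y \<in> ball 0 1" "f x = f y"
    show "x = y"
    proof (cases "x = 0 \<or> y = 0")
      case True thus ?thesis using xy by (auto simp: f_def)
    next
      case False
      hence "\<phi> x = \<phi> y" using f\<phi>[of x] f\<phi>[of y] xy by (metis mem_ball_0 mult_left_cancel zero_neq_one mult_zero_left)
      thus ?thesis using inj_onD[OF inj, of x y] False xy by auto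
    qed
  qed
  have "open (f ` ball 0 \<rho>)"
    by (rule open_mapping_thm3) (use assms in \<open>auto intro!: holomorphic_on_subset[OF f] inj_on_subset[OF injf]\<close>)
  moreover have "0 \<in> f ` ball 0 \<rho>" using assms by (intro image_eqI[of _ _ 0]) (auto simp: f_def)
  ultimately obtain d where d: "d > 0" "ball 0 d \<subseteq> f ` ball 0 \<rho>"
    using openE by blast
  show ?thesis
  proof (intro exI[of _ "1 / d"] conjI allI impI)
    show "1 / d > 0" using d by simp
    fix z :: complex assume z: "\<rho> \<le> norm z" "norm z < 1"
    have "f z \<notin> f ` ball 0 \<rho>"
      using z assms inj_on_image_mem_iff[OF injf, of z "ball 0 \<rho>"] by (auto simp: subset_iff)
    hence "norm (f z) \<ge> d" using d by (metis mem_ball_0 not_le subsetD)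
    moreover have "norm (f z) * norm (\<phi> z) = 1" 
      using f\<phi>[of z] z assms by (metis norm_mult norm_one norm_zero not_le)
    ultimately show "norm (\<phi> z) \<le> 1 / d" using d
      by (metis mult_right_mono norm_ge_zero pos_le_divide_eq mult.commute)
  qed
qed

lemma ex_inverse:
  obtains \<psi> where "continuous_on (- X) \<psi>" "\<And>w. w \<in> - X \<Longrightarrow> \<psi> w \<in> ball 0 1 - {0} \<and> \<phi> (\<psi> w) = w"
    "\<And>z::complex. z \<noteq> 0 \<Longrightarrow> norm z < 1 \<Longrightarrow> \<psi> (\<phi> z) = z"
proof -
  have o: "open (ball 0 1 - {0::complex})" by (intro open_Diff) auto
  obtain \<psi> where \<psi>: "\<psi> holomorphic_on (\<phi> ` (ball 0 1 - {0}))" "\<And>z. z \<in> ball 0 1 - {0} \<Longrightarrow> \<psi> (\<phi> z) = z"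
    using holomorphic_has_inverse[OF holo o inj] by metis
  have im: "\<phi> ` (ball 0 1 - {0}) = - X" using bij by (simp add: bij_betw_def)
  show ?thesis
  proof
    show "continuous_on (- X) \<psi>" using \<psi>(1) im holomorphic_on_imp_continuous_on by metis
    show "\<psi> w \<in> ball 0 1 - {0} \<and> \<phi> (\<psi> w) = w" if "w \<in> - X" for w
      using that \<psi>(2) unfolding im[symmetric] by auto
  qed (use \<psi> in auto)
qed

text \<open>
  As the inverse of \<open>\<phi>\<close> is continuous, a cluster value outside \<open>X\<close> along a ray can only come from an
  interior radius.
\<close>
lemma ray_cluster_point:
  assumes r: "\<And>n. 0 < r n \<and> r n < (1::real)" "r \<longlonglongrightarrow> r0" "r0 \<le> 1" "0 < r0"
    and p: "(\<lambda>n. \<phi> (rcis (r n) \<theta>)) \<longlonglongrightarrow> p" and out: "p \<in> - X"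
  shows "r0 < 1 \<and> p = \<phi> (rcis r0 \<theta>)"
proof -
  obtain \<psi> where \<psi>: "continuous_on (- X) \<psi>" "\<And>w. w \<in> - X \<Longrightarrow> \<psi> w \<in> ball 0 1 - {0} \<and> \<phi> (\<psi> w) = w"
    "\<And>z::complex. z \<noteq> 0 \<Longrightarrow> norm z < 1 \<Longrightarrow> \<psi> (\<phi> z) = z" using ex_inverse by blast
  have "open (- X)" using comp compact_imp_closed by blast
  hence "isCont \<psi> p" using \<psi>(1) out continuous_on_eq_continuous_at by blast
  hence "(\<lambda>n. \<psi> (\<phi> (rcis (r n) \<theta>))) \<longlonglongrightarrow> \<psi> p" using p isCont_tendsto_compose by blast
  moreover have "\<psi> (\<phi> (rcis (r n) \<theta>)) = rcis (r n) \<theta>" for n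
    using r(1)[of n] by (intro \<psi>(3)) auto
  ultimately have "(\<lambda>n. rcis (r n) \<theta>) \<longlonglongrightarrow> \<psi> p" by simp
  moreover have "(\<lambda>n. rcis (r n) \<theta>) \<longlonglongrightarrow> rcis r0 \<theta>"
    unfolding rcis_def by (intro tendsto_intros r)
  ultimately have "\<psi> p = rcis r0 \<theta>" using LIMSEQ_unique by blast
  thus ?thesis using \<psi>(2)[OF out] r by (auto simp: norm_mult)
qed

text \<open>
  Near the circle \<open>\<phi>\<close> is bounded, and by the previous lemma all cluster values at the end of a ray lie in \<open>X\<close>; if
  \<open>0\<close> is the only point of the closure off the ray, every cluster value is \<open>0\<close>. In the other direction, the
  pole keeps the beginning of the ray from contributing to the closure.
\<close>
lemma ray_lands_iff_tendsto:
  "ray_lands \<phi> \<theta> 0 \<longleftrightarrow> ((\<lambda>r. \<phi> (rcis r \<theta>)) \<longlongrightarrow> 0) (at_left 1)"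
proof
  assume land: "ray_lands \<phi> \<theta> 0"
  show "((\<lambda>r. \<phi> (rcis r \<theta>)) \<longlongrightarrow> 0) (at_left 1)"
  proof (rule ccontr)
    assume "\<not> ?thesis"
    then obtain e where e: "e > 0" "\<not> (\<forall>\<^sub>F r in at_left 1. dist (\<phi> (rcis r \<theta>)) 0 < e)"
      by (auto simp: tendsto_iff)
    have "\<exists>r. b < r \<and> r < 1 \<and> e \<le> norm (\<phi> (rcis r \<theta>))" if "b < 1" for b
    proof -
      have "\<not> (\<forall>y>b. y < 1 \<longrightarrow> dist (\<phi> (rcis y \<theta>)) 0 < e)"
        using e(2) that unfolding eventually_at_left[OF that] by blast
      thus ?thesis by (auto simp: not_less)
    qed
    hence "\<forall>n. \<exists>r. 1 - 1 / real (n + 2) < r \<and> r < 1 \<and> e \<le> norm (\<phi> (rcis r \<theta>))"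
      by (intro allI) (simp del: of_nat_add)
    then obtain r where "\<forall>n. 1 - 1 / real (n + 2) < r n \<and> r n < 1 \<and> e \<le> norm (\<phi> (rcis (r n) \<theta>))"
      unfolding choice_iff by blast
    hence r: "1 - 1 / real (n + 2) < r n" "r n < 1" "e \<le> norm (\<phi> (rcis (r n) \<theta>))" for n
      by blast+
    have r2: "1 / 2 < r n" for n
    proof -
      have "1 / real (n + 2) \<le> 1 / 2" by (simp add: field_simps)
      thus ?thesis using r(1)[of n] by linarith
    qed
    have rlim: "r \<longlonglongrightarrow> 1"
    proof (rule tendsto_sandwich[OF _ _ _ tendsto_const])
      show "(\<lambda>n. 1 - 1 / real (n + 2)) \<longlonglongrightarrow> 1" 
        using tendsto_diff[OF tendsto_const LIMSEQ_ignore_initial_segment[OF lim_1_over_n, of 2], of "1::real"] by simp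
      show "\<forall>\<^sub>F n in sequentially. 1 - 1 / real (n + 2) \<le> r n"
        by (intro always_eventually allI less_imp_le r(1))
      show "\<forall>\<^sub>F n in sequentially. r n \<le> 1"
        by (intro always_eventually allI less_imp_le r(2))
    qed
    obtain C where C: "\<forall>z. 1/2 \<le> norm z \<longrightarrow> norm z < 1 \<longrightarrow> norm (\<phi> z) \<le> C"
      using bounded_near_circle[of "1/2"] by auto
    have r0: "0 < r n" for n using r2[of n] by linarith
    have "norm (\<phi> (rcis (r n) \<theta>)) \<le> C" for n
      using r2[of n] r(2)[of n] by (intro C[rule_format]) auto
    hence "bounded (range (\<lambda>n. \<phi> (rcis (r n) \<theta>)))"
      by (auto simp: bounded_iff)
    then obtain p s where ps: "strict_mono s" "((\<lambda>n. \<phi> (rcis (r n) \<theta>)) \<circ> s) \<longlonglongrightarrow> p"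
      using bounded_imp_convergent_subsequence by blast
    from ps(2) have ps2: "(\<lambda>n. \<phi> (rcis (r (s n)) \<theta>)) \<longlonglongrightarrow> p" by (simp add: o_def)
    have pe: "e \<le> norm p"
      by (rule tendsto_lowerbound[OF tendsto_norm[OF ps2]]) (use r(3) in simp_all)
    have "\<phi> (rcis (r (s n)) \<theta>) \<in> external_ray \<phi> \<theta>" for n
      using r(2) r0 by (simp add: external_ray_def)
    hence "\<forall>n. \<phi> (rcis (r (s n)) \<theta>) \<in> external_ray \<phi> \<theta>" by blast
    with ps2 have "p \<in> closure (external_ray \<phi> \<theta>)"
      unfolding closure_sequential by (intro exI[of _ "\<lambda>n. \<phi> (rcis (r (s n)) \<theta>)"] conjI)
    moreover have "p \<notin> closure (external_ray \<phi> \<theta>) - external_ray \<phi> \<theta>"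
      using pe e(1) unfolding land[unfolded ray_lands_def] by auto
    ultimately have "p \<in> external_ray \<phi> \<theta>" by blast
    then obtain t where "0 < t" "t < 1" "p = \<phi> (rcis t \<theta>)" by (auto simp: external_ray_def)
    hence "p \<in> - X" using in_exterior[of "rcis t \<theta>"] by simp
    moreover have "(\<lambda>n. r (s n)) \<longlonglongrightarrow> 1" using LIMSEQ_subseq_LIMSEQ[OF rlim ps(1)] by (simp add: o_def)
    ultimately show False
      using ray_cluster_point[of "\<lambda>n. r (s n)" 1 \<theta> p] ps2 r(2) r0 by simp
  qed
next
  assume lim: "((\<lambda>r. \<phi> (rcis r \<theta>)) \<longlongrightarrow> 0) (at_left 1)"
  have notin: "0 \<notin> external_ray \<phi> \<theta>"
  proof
    assume "0 \<in> external_ray \<phi> \<theta>"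
    then obtain r where "0 < r" "r < 1" "\<phi> (rcis r \<theta>) = 0" by (auto simp: external_ray_def)
    thus False using nonzero[of "rcis r \<theta>"] by simp
  qed
  have "0 \<in> closure (external_ray \<phi> \<theta>)"
  proof (rule Lim_in_closed_set[OF closed_closure _ _ lim])
    show "\<forall>\<^sub>F r in at_left 1. \<phi> (rcis r \<theta>) \<in> closure (external_ray \<phi> \<theta>)"
    proof (rule eventually_mono)
      show "\<forall>\<^sub>F r in at_left 1. r \<in> {0<..<(1::real)}" by (rule eventually_at_left_real) simp
      show "\<phi> (rcis r \<theta>) \<in> closure (external_ray \<phi> \<theta>)" if "r \<in> {0<..<1}" for r
        using that unfolding external_ray_def by (intro closure_subset[THEN subsetD] imageI)
    qed
  qed auto
  moreover have "p = 0" if p: "p \<in> closure (external_ray \<phi> \<theta>)" "p \<notin> external_ray \<phi> \<theta>" for p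
  proof -
    obtain q where q: "\<And>n. q n \<in> external_ray \<phi> \<theta>" "q \<longlonglongrightarrow> p"
      using p(1) unfolding closure_sequential by blast
    have "\<exists>r. 0 < r \<and> r < 1 \<and> q n = \<phi> (rcis r \<theta>)" for n
      using q(1)[of n] by (auto simp: external_ray_def)
    then obtain r where r: "\<And>n. 0 < r n" "\<And>n. r n < 1" "\<And>n. q n = \<phi> (rcis (r n) \<theta>)" by metis
    have "norm (r n) \<le> 1" for n using r(1,2)[of n] by simp
    hence "bounded (range r)" by (auto simp: bounded_iff)
    then obtain r0 s where s: "strict_mono s" "(r \<circ> s) \<longlonglongrightarrow> r0"
      using bounded_imp_convergent_subsequence by blast
    from s(2) have s2: "(\<lambda>n. r (s n)) \<longlonglongrightarrow> r0" by (simp add: o_def)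
    note s = s(1) s2
    have r0: "0 \<le> r0" "r0 \<le> 1"
      by (rule tendsto_lowerbound[OF s(2)] tendsto_upperbound[OF s(2)]; use r in \<open>simp add: less_imp_le\<close>)+
    have qs: "(\<lambda>n. \<phi> (rcis (r (s n)) \<theta>)) \<longlonglongrightarrow> p"
      using LIMSEQ_subseq_LIMSEQ[OF q(2) s(1)] r(3) by (simp add: o_def)
    consider "r0 = 0" | "r0 = 1" | "0 < r0" "r0 < 1" using r0 by linarith
    thus ?thesis
    proof cases
      case 1
      have "filterlim (\<lambda>n. rcis (r (s n)) \<theta>) (at 0) sequentially"
      proof (rule filterlim_atI)
        have "(\<lambda>n. rcis (r (s n)) \<theta>) \<longlonglongrightarrow> of_real 0 * cis \<theta>"
          unfolding rcis_def using s(2) 1 by (intro tendsto_intros) auto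
        thus "(\<lambda>n. rcis (r (s n)) \<theta>) \<longlonglongrightarrow> 0" by simp
        show "\<forall>\<^sub>F n in sequentially. rcis (r (s n)) \<theta> \<noteq> 0" using r(1) by (simp add: less_imp_neq[symmetric])
      qed
      hence "filterlim (\<lambda>n. \<phi> (rcis (r (s n)) \<theta>)) at_infinity sequentially"
        using pole unfolding is_pole_def by (rule filterlim_compose[rotated])
      thus ?thesis using not_tendsto_and_filterlim_at_infinity[OF _ qs] by simp
    next
      case 2
      have "filterlim (\<lambda>n. r (s n)) (at_left 1) sequentially"
        unfolding filterlim_at using s(2) 2 r(2) by (simp add: less_imp_neq)
      hence "(\<lambda>n. \<phi> (rcis (r (s n)) \<theta>)) \<longlonglongrightarrow> 0"
        using filterlim_compose[OF lim] by blast
      thus ?thesis using qs LIMSEQ_unique by blast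
    next
      case 3
      have "isCont \<phi> (rcis r0 \<theta>)"
        using holomorphic_on_imp_continuous_on[OF holo] 3
          continuous_on_eq_continuous_at[of "ball 0 1 - {0::complex}" \<phi>]
        by (simp add: open_Diff)
      moreover have "(\<lambda>n. rcis (r (s n)) \<theta>) \<longlonglongrightarrow> rcis r0 \<theta>"
        unfolding rcis_def by (intro tendsto_intros s)
      ultimately have "(\<lambda>n. \<phi> (rcis (r (s n)) \<theta>)) \<longlonglongrightarrow> \<phi> (rcis r0 \<theta>)"
        by (rule isCont_tendsto_compose)
      hence "p = \<phi> (rcis r0 \<theta>)" using qs LIMSEQ_unique by blast
      thus ?thesis using p(2) 3 by (auto simp: external_ray_def)
    qed
  qed
  ultimately show "ray_lands \<phi> \<theta> 0" using notin by (auto simp: ray_lands_def)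
qed

text \<open>
  The lift of \<open>\<phi>\<close> through \<open>exp\<close>. Since \<open>\<phi> z = exp (log_factor z) / z\<close>, it has the closed form below, from which
  its behaviour under translation by \<open>2 pi i\<close> can be read off.
\<close>
definition lift :: "complex \<Rightarrow> complex" where
  "lift w = log_factor (exp w) - w"

lemma exp_lift: "Re w < 0 \<Longrightarrow> exp (lift w) = \<phi> (exp w)"
  using log_factor[of "exp w"] by (simp add: lift_def exp_diff norm_exp_eq_Re field_simps)

lemma lift_holo: "lift holomorphic_on {w. Re w < 0}"
  unfolding lift_def[abs_def]
  by (intro holomorphic_intros holomorphic_on_compose_gen[OF _ log_factor_holo, unfolded o_def]) auto

lemma lift_shift: "lift (w + 2 * of_int n * of_real pi * \<i>) = lift w - 2 * of_int n * of_real pi * \<i>"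
proof -
  have "exp (w + 2 * of_int n * of_real pi * \<i>) = exp w"
    unfolding exp_add using exp_integer_2pi[of "of_int n"] by (simp add: mult_ac)
  thus ?thesis by (simp add: lift_def)
qed

lemma minus_hat: "- hat X = exp -` (- X)"
  using zero by (auto simp: hat_def)

lemma inj_lift: "inj_on lift {w. Re w < 0}"
proof (rule inj_onI)
  fix v w assume vw: "v \<in> {w. Re w < 0}" "w \<in> {w. Re w < 0}" "lift v = lift w"
  hence "\<phi> (exp v) = \<phi> (exp w)" using exp_lift by (metis mem_Collect_eq)
  hence "exp v = exp w" using inj_onD[OF inj, of "exp v" "exp w"] vw by simp
  then obtain n :: int where n: "v = w + 2 * of_int n * of_real pi * \<i>"
    by (auto simp: exp_eq)
  hence "2 * of_int n * of_real pi * \<i> = (0::complex)" using vw(3) lift_shift[of w n] by simp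
  thus "v = w" using n by simp
qed

text \<open>
  A preimage of \<open>exp z\<close> under \<open>\<phi> \<circ> exp\<close> lifts \<open>z\<close> up to a multiple of \<open>2 pi i\<close>, which a translation corrects.
\<close>
lemma lift_surj:
  assumes "z \<in> - hat X" obtains w where "Re w < 0" "lift w = z"
proof -
  have "exp z \<in> - X" using assms minus_hat by auto
  then obtain \<zeta> where \<zeta>: "\<zeta> \<in> ball 0 1 - {0}" "\<phi> \<zeta> = exp z"
    using bij by (metis bij_betw_def imageE)
  define w where "w = Ln \<zeta>"
  have w: "exp w = \<zeta>" "Re w < 0" using \<zeta> by (auto simp: w_def)
  have "exp (lift w) = exp z" using exp_lift[OF w(2)] w \<zeta> by simp
  then obtain n :: int where n: "lift w = z + 2 * of_int n * of_real pi * \<i>"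
    by (auto simp: exp_eq)
  show ?thesis
    using that[of "w + 2 * of_int n * of_real pi * \<i>"] n lift_shift[of w n] w(2) by simp
qed

text \<open>
  The lift is proper: its inverse is holomorphic, hence continuous, and maps compact sets to compact sets.
\<close>
lemma compact_lift_preimage:
  assumes "compact K" "K \<subseteq> - hat X"
  shows "compact {w. Re w < 0 \<and> lift w \<in> K}"
proof -
  have o: "open {w. Re w < 0}" by (rule open_halfspace_Re_lt)
  obtain g where g: "g holomorphic_on (lift ` {w. Re w < 0})" "\<And>w. w \<in> {w. Re w < 0} \<Longrightarrow> g (lift w) = w"
    using holomorphic_has_inverse[OF lift_holo o inj_lift] by metis
  have K: "\<exists>w. Re w < 0 \<and> lift w = z" if "z \<in> K" for z
    using lift_surj[of z] assms(2) that by blast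
  have K': "K \<subseteq> lift ` {w. Re w < 0}" using K by blast
  have "w \<in> g ` K" if "Re w < 0" "lift w \<in> K" for w
    using g(2)[of w] that by (intro image_eqI[of _ _ "lift w"]) auto
  moreover have "Re (g z) < 0 \<and> lift (g z) \<in> K" if "z \<in> K" for z
    using K[OF that] g(2) that by auto
  ultimately have "{w. Re w < 0 \<and> lift w \<in> K} = g ` K" by blast
  moreover have "continuous_on K g"
    using holomorphic_on_imp_continuous_on[OF g(1)] K' continuous_on_subset by blast
  ultimately show ?thesis using assms(1) by (simp add: compact_continuous_image)
qed

end

section \<open>A boundary point whose semicircles cross a level set\<close>

text \<open>
  Let \<open>U\<close> be the component of \<open>{h < 0}\<close> in the strip that contains the lower line. It stays below the upper line,
  so there is a highest \<open>t\<close> such that \<open>i t\<close> is in the closure of \<open>U\<close>. A small semicircle about \<open>i t\<close> meets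
  \<open>U\<close>, because \<open>U\<close> is connected and reaches both sides of it. If \<open>h\<close> had no zero on the semicircle, all of it
  would lie in \<open>U\<close>, and its upper end point would contradict the choice of \<open>t\<close>.
\<close>
lemma ex_point_with_crossing_semicircles:
  fixes h :: "complex \<Rightarrow> real"
  assumes cont: "continuous_on {w. -1 < Re w \<and> Re w < 0} h" and ss: "s < s'"
    and neg: "\<And>u. -1 < u \<Longrightarrow> u < 0 \<Longrightarrow> h (Complex u s) < 0"
    and pos: "\<And>u. -1 < u \<Longrightarrow> u < 0 \<Longrightarrow> 0 < h (Complex u s')"
  shows "\<exists>t. \<forall>\<rho>\<in>{0<..<1/4}. \<exists>y\<in>{-(pi/2)<..<pi/2}. h (Complex 0 t - of_real \<rho> * cis y) = 0"
proof -
  define H where "H = {w. -1 < Re w \<and> Re w < 0 \<and> h w < 0}"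
  define U where "U = connected_component_set H (Complex (-1/2) s)"
  have UH: "U \<subseteq> H" unfolding U_def by (rule connected_component_subset)
  have conU: "connected U" unfolding U_def by simp
  have line: "(\<lambda>u. Complex u s) ` {-1<..<0} \<subseteq> U" unfolding U_def
  proof (rule connected_component_maximal)
    show "connected ((\<lambda>u. Complex u s) ` {-1<..<0})"
      unfolding Complex_eq by (intro connected_continuous_image continuous_intros) auto
  qed (auto simp: H_def neg)
  have below: "Im w < s'" if w: "w \<in> U" for w
  proof (rule ccontr)
    assume "\<not> Im w < s'"
    have "Complex (-1/2) s \<in> U" using line by (auto simp: image_subset_iff)
    hence "s \<in> Im ` U" by (rule rev_image_eqI) simp
    moreover have "Im w \<in> Im ` U" using w by (rule imageI)
    moreover have "connected (Im ` U)" by (intro connected_continuous_image continuous_on_Im continuous_on_id conU)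
    ultimately have "{s..Im w} \<subseteq> Im ` U" by (intro connected_contains_Icc)
    hence "s' \<in> Im ` U" using ss \<open>\<not> Im w < s'\<close> by (auto simp: subset_iff)
    then obtain v where v: "v \<in> U" "Im v = s'" by auto
    hence "v = Complex (Re v) s'" by (simp add: complex_eq_iff)
    hence "0 < h v" using pos[of "Re v"] v UH by (auto simp: H_def)
    thus False using v UH by (auto simp: H_def)
  qed
  define T where "T = {t. Complex 0 t \<in> closure U}"
  have sT: "s \<in> T"
  proof -
    have "((\<lambda>u. Complex u s) \<longlongrightarrow> Complex 0 s) (at_left 0)"
      unfolding Complex_eq by (auto intro!: tendsto_eq_intros)
    moreover have "\<forall>\<^sub>F u in at_left 0. Complex u s \<in> closure U"
    proof (rule eventually_mono)
      show "\<forall>\<^sub>F u in at_left 0. u \<in> {-1<..<(0::real)}" by (rule eventually_at_left_real) simp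
      show "Complex u s \<in> closure U" if "u \<in> {-1<..<0}" for u
        using line that closure_subset[of U] by blast
    qed
    ultimately show ?thesis unfolding T_def by (simp add: Lim_in_closed_set)
  qed
  have clT: "closed T"
  proof -
    have "closed ((\<lambda>t. Complex 0 t) -` closure U)"
      unfolding Complex_eq by (intro closed_vimage closed_closure continuous_intros)
    thus ?thesis by (simp add: T_def vimage_def)
  qed
  have Tb: "t \<le> s'" if "t \<in> T" for t
  proof -
    have "closure U \<subseteq> {w. Im w \<le> s'}"
      by (rule closure_minimal) (use below in \<open>auto simp: less_imp_le closed_halfspace_Im_le\<close>)
    thus ?thesis using that by (auto simp: T_def)
  qed
  hence bdd: "bdd_above T" by (rule bdd_aboveI)
  define t where "t = Sup T"
  have tT: "t \<in> T" unfolding t_def using closed_contains_Sup[of T] sT bdd clT by blast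
  have tmax: "t' \<le> t" if "t' \<in> T" for t' unfolding t_def by (rule cSup_upper[OF that bdd])
  show ?thesis
  proof (intro exI[of _ t] ballI, rule ccontr)
    fix \<rho> :: real assume \<rho>: "\<rho> \<in> {0<..<1/4}"
    define C where "C = (\<lambda>y. Complex 0 t - of_real \<rho> * cis y) ` {-(pi/2)<..<pi/2}"
    assume "\<not> (\<exists>y\<in>{-(pi/2)<..<pi/2}. h (Complex 0 t - of_real \<rho> * cis y) = 0)"
    hence nz: "h w \<noteq> 0" if "w \<in> C" for w using that by (auto simp: C_def)
    have conC: "connected C" unfolding C_def cis_conv_exp
      by (intro connected_continuous_image continuous_intros) auto
    have Cstrip: "-1 < Re w \<and> Re w < 0" if wC: "w \<in> C" for w
    proof -
      obtain y where y: "y \<in> {-(pi/2)<..<pi/2}" "w = Complex 0 t - of_real \<rho> * cis y"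
        using wC unfolding C_def by blast
      have "0 < cos y" using y(1) by (intro cos_gt_zero_pi) auto
      hence "0 < \<rho> * cos y" "\<rho> * cos y \<le> \<rho> * 1" using \<rho> by (auto intro!: mult_left_mono)
      thus ?thesis using y(2) \<rho> by auto
    qed
    \<comment> \<open>\<open>U\<close> has points arbitrarily close to \<open>i t\<close> and a point with real part \<open>- 3/4\<close>, at distance more than \<open>\<rho>\<close>.\<close>
    have "\<exists>w\<in>U. norm (Complex 0 t - w) = \<rho>"
    proof -
      have con: "connected ((\<lambda>w. norm (Complex 0 t - w)) ` U)"
        by (intro connected_continuous_image continuous_intros conU)
      obtain v where v: "v \<in> U" "norm (v - Complex 0 t) < \<rho>"
        using tT \<rho> by (auto simp: T_def closure_approachable dist_norm)
      have "Complex (-3/4) s \<in> U" using line by (auto simp: image_subset_iff)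
      hence "{norm (Complex 0 t - v)..norm (Complex 0 t - Complex (-3/4) s)} \<subseteq> (\<lambda>w. norm (Complex 0 t - w)) ` U"
        using v(1) by (intro connected_contains_Icc con imageI)
      moreover have "\<rho> \<le> norm (Complex 0 t - Complex (-3/4) s)"
        using abs_Re_le_cmod[of "Complex 0 t - Complex (-3/4) s"] \<rho> by simp
      moreover have "norm (Complex 0 t - v) \<le> \<rho>" using v(2) by (simp add: norm_minus_commute)
      ultimately have "\<rho> \<in> (\<lambda>w. norm (Complex 0 t - w)) ` U" by auto
      thus ?thesis by auto
    qed
    then obtain w where w: "w \<in> U" "norm (Complex 0 t - w) = \<rho>" by blast
    have wC: "w \<in> C"
    proof -
      define y where "y = Arg (Complex 0 t - w)"
      have "0 < Re (Complex 0 t - w)" using w(1) UH by (auto simp: H_def)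
      hence "y \<in> {-(pi/2)<..<pi/2}" using Arg_Re_pos[of "Complex 0 t - w"] by (auto simp: y_def abs_less_iff)
      moreover have "Complex 0 t - w = of_real \<rho> * cis y"
        using rcis_cmod_Arg[of "Complex 0 t - w"] w(2) by (simp add: y_def rcis_def)
      hence "w = Complex 0 t - of_real \<rho> * cis y" by (simp add: algebra_simps)
      ultimately show ?thesis unfolding C_def by blast
    qed
    have "h v < 0" if v: "v \<in> C" for v
    proof (rule ccontr)
      assume "\<not> h v < 0"
      have "connected (h ` C)"
        using Cstrip by (intro connected_continuous_image conC continuous_on_subset[OF cont]) auto
      hence "{h w..h v} \<subseteq> h ` C" using wC v by (intro connected_contains_Icc imageI)
      moreover have "h w < 0" using w(1) UH by (auto simp: H_def)
      ultimately have "0 \<in> h ` C" using \<open>\<not> h v < 0\<close> by (auto simp: subset_iff)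
      thus False using nz by force
    qed
    hence "C \<subseteq> H" using Cstrip by (auto simp: H_def)
    hence CU: "C \<subseteq> U"
    proof -
      have "U = connected_component_set H w"
        using w(1) unfolding U_def by (metis connected_component_eq)
      thus ?thesis using connected_component_maximal[OF wC conC \<open>C \<subseteq> H\<close>] by simp
    qed
    \<comment> \<open>The end \<open>y \<rightarrow> - pi/2\<close> of the semicircle is the point \<open>i (t + \<rho>)\<close>.\<close>
    have "((\<lambda>y. Complex 0 t - of_real \<rho> * cis y) \<longlongrightarrow> Complex 0 t - of_real \<rho> * cis (-(pi/2))) (at_right (-(pi/2)))"
      unfolding cis_conv_exp by (intro tendsto_intros)
    moreover have "\<forall>\<^sub>F y in at_right (-(pi/2)). Complex 0 t - of_real \<rho> * cis y \<in> closure U"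
    proof (rule eventually_mono)
      show "\<forall>\<^sub>F y in at_right (-(pi/2)). y \<in> {-(pi/2)<..<pi/2}" by (rule eventually_at_right_real) simp
      show "Complex 0 t - of_real \<rho> * cis y \<in> closure U" if "y \<in> {-(pi/2)<..<pi/2}" for y
        using CU that closure_subset[of U] unfolding C_def by blast
    qed
    ultimately have "Complex 0 t - of_real \<rho> * cis (-(pi/2)) \<in> closure U" by (simp add: Lim_in_closed_set)
    moreover have "Complex 0 t - of_real \<rho> * cis (-(pi/2)) = Complex 0 (t + \<rho>)"
      by (simp add: complex_eq_iff)
    ultimately have "t + \<rho> \<in> T" by (simp add: T_def)
    thus False using tmax \<rho> by fastforce
  qed
qed

section \<open>From a separation to a landing ray\<close>

text \<open>
  Far out in a vertical strip there is, by periodicity, a point of \<open>P \<union> Q\<close> within bounded distance \<open>c\<close>,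
  and it cannot belong to \<open>Q\<close>, whereas points of \<open>Q\<close> within distance \<open>c\<close> are excluded by the bound on \<open>Q\<close> in a
  slightly larger half plane. The sign \<open>\<sigma>\<close> selects the upward or the downward direction.
\<close>
lemma nearer_part_far_out:
  fixes P Q :: "complex set" and \<sigma> :: real
  assumes per: "\<And>z n. z \<in> P \<union> Q \<Longrightarrow> z + 2 * of_int n * of_real pi * \<i> \<in> P \<union> Q"
    and Q: "closed Q" "Q \<noteq> {}" and \<sigma>: "\<bar>\<sigma>\<bar> = 1"
    and bd: "\<And>x. \<exists>y. \<forall>z\<in>Q. x \<le> Re z \<longrightarrow> \<sigma> * Im z < y"
  shows "\<exists>Y. \<forall>z. a \<le> Re z \<longrightarrow> Re z \<le> b \<longrightarrow> Y \<le> \<sigma> * Im z \<longrightarrow> infdist z P < infdist z Q"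
proof -
  obtain f0 where f0: "f0 \<in> Q" using Q(2) by blast
  define c where "c = \<bar>a\<bar> + \<bar>b\<bar> + \<bar>Re f0\<bar> + 2 * pi"
  obtain y1 where y1: "\<And>z. z \<in> Q \<Longrightarrow> Re f0 \<le> Re z \<Longrightarrow> \<sigma> * Im z < y1" using bd by blast
  obtain y2 where y2: "\<And>z. z \<in> Q \<Longrightarrow> a - c \<le> Re z \<Longrightarrow> \<sigma> * Im z < y2" using bd by blast
  have \<sigma>': "\<bar>\<sigma> * s - \<sigma> * t\<bar> = \<bar>s - t\<bar>" for s t
    using \<sigma> by (simp add: abs_mult flip: right_diff_distrib)
  show ?thesis
  proof (intro exI[of _ "max (y1 + 2 * pi) (y2 + c)"] allI impI)
    fix z assume z: "a \<le> Re z" "Re z \<le> b" "max (y1 + 2 * pi) (y2 + c) \<le> \<sigma> * Im z"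
    define n where "n = \<lfloor>(Im z - Im f0) / (2 * pi)\<rfloor>"
    define w where "w = f0 + 2 * of_int n * of_real pi * \<i>"
    have w: "Re w = Re f0" "Im w = Im f0 + 2 * of_int n * pi" by (simp_all add: w_def)
    have "of_int n \<le> (Im z - Im f0) / (2 * pi)" "(Im z - Im f0) / (2 * pi) < of_int n + 1"
      unfolding n_def by linarith+
    hence "of_int n * (2 * pi) \<le> Im z - Im f0" "Im z - Im f0 < (of_int n + 1) * (2 * pi)"
      by (simp_all add: pos_le_divide_eq pos_divide_less_eq)
    hence Imzw: "\<bar>Im z - Im w\<bar> \<le> 2 * pi" unfolding w by (simp add: algebra_simps)
    have "norm (z - w) \<le> \<bar>Re (z - w)\<bar> + \<bar>Im (z - w)\<bar>" by (rule cmod_le)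
    also have "\<dots> \<le> c" using Imzw z(1,2) w(1) unfolding c_def by simp
    finally have dzw: "dist z w \<le> c" by (simp add: dist_norm)
    have "w \<notin> Q"
    proof
      assume "w \<in> Q"
      hence "\<sigma> * Im w < y1" using y1 w(1) by simp
      thus False using z(3) \<sigma>'[of "Im z" "Im w"] Imzw by linarith
    qed
    hence "w \<in> P" using per[of f0 n] f0 by (auto simp: w_def)
    hence P: "infdist z P \<le> c" using infdist_le[of w P z] dzw by simp
    obtain q where q: "q \<in> Q" "infdist z Q = dist z q"
      using infdist_attains_inf[OF Q] by metis
    have "c < dist z q"
    proof (rule ccontr)
      assume "\<not> c < dist z q"
      hence "norm (z - q) \<le> c" by (simp add: dist_norm)
      hence "\<bar>Re z - Re q\<bar> \<le> c" "\<bar>Im z - Im q\<bar> \<le> c"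
        using abs_Re_le_cmod[of "z - q"] abs_Im_le_cmod[of "z - q"] by simp_all
      hence "\<sigma> * Im q < y2" "\<bar>\<sigma> * Im z - \<sigma> * Im q\<bar> \<le> c"
        using y2[OF q(1)] z(1) \<sigma>'[of "Im z" "Im q"] by linarith+
      thus False using z(3) by linarith
    qed
    thus "infdist z P < infdist z Q" using P q by simp
  qed
qed

context exterior_map
begin

lemma inj_\<phi>_exp: "inj_on (\<lambda>w. \<phi> (exp w)) {w. Re w < 0 \<and> 0 < Im w \<and> Im w < 2 * pi}"
proof (rule inj_onI)
  fix v w assume vw: "v \<in> {w. Re w < 0 \<and> 0 < Im w \<and> Im w < 2 * pi}" "w \<in> {w. Re w < 0 \<and> 0 < Im w \<and> Im w < 2 * pi}"
     "\<phi> (exp v) = \<phi> (exp w)"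
  have "exp v = exp w" using inj_onD[OF inj vw(3)] vw(1,2) by simp
  then obtain n :: int where n: "v = w + (of_int (2 * n) * pi) * \<i>" by (auto simp: exp_eq)
  hence "2 * pi * of_int n = Im v - Im w" by (simp add: mult_ac)
  hence "\<bar>2 * pi * of_int n\<bar> < 2 * pi" using vw(1,2) by auto
  hence "\<bar>of_int n\<bar> < (1::real)" by (simp add: abs_mult)
  hence "n = 0" by linarith
  thus "v = w" using n by simp
qed

lemma \<phi>_exp_holo: "(\<lambda>w. \<phi> (exp w)) holomorphic_on {w. Re w < 0}"
  by (rule holomorphic_on_compose_gen[OF _ holo, unfolded o_def]) (auto intro!: holomorphic_intros)

lemma rcis_eq_exp: "0 < r \<Longrightarrow> rcis r \<theta> = exp (Complex (ln r) \<theta>)"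
  by (simp add: rcis_def exp_eq_polar)

lemma tendsto_horizontal_imp_ray_lands:
  assumes "((\<lambda>x. \<phi> (exp (Complex x \<theta>))) \<longlongrightarrow> 0) (at_left 0)"
  shows "ray_lands \<phi> \<theta> 0"
proof -
  have "filterlim ln (at_left (0::real)) (at_left 1)"
    unfolding filterlim_at
  proof (intro conjI)
    have "isCont ln (1::real)" by (intro isCont_ln) auto
    thus "(ln \<longlongrightarrow> (0::real)) (at_left 1)"
      by (auto simp: isCont_def intro: filterlim_mono[OF _ order_refl at_le])
    have "\<forall>\<^sub>F r in at_left (1::real). r \<in> {0<..<1}" by (rule eventually_at_left_real) simp
    thus "\<forall>\<^sub>F r in at_left (1::real). ln r \<in> {..<0} \<and> ln r \<noteq> 0"
      by (rule eventually_mono) auto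
  qed
  from filterlim_compose[OF assms this]
  have "((\<lambda>r. \<phi> (exp (Complex (ln r) \<theta>))) \<longlongrightarrow> 0) (at_left 1)" .
  moreover have "\<forall>\<^sub>F r in at_left (1::real). \<phi> (exp (Complex (ln r) \<theta>)) = \<phi> (rcis r \<theta>)"
  proof (rule eventually_mono)
    show "\<forall>\<^sub>F r in at_left (1::real). r \<in> {0<..<1}" by (rule eventually_at_left_real) simp
  qed (simp add: rcis_eq_exp)
  ultimately have "((\<lambda>r. \<phi> (rcis r \<theta>)) \<longlongrightarrow> 0) (at_left 1)"
    by (rule Lim_transform_eventually)
  thus ?thesis by (simp add: ray_lands_iff_tendsto)
qed

text \<open>
  A half-line of finite energy has a limit \<open>p\<close> of \<open>\<phi> \<circ> exp\<close>. If \<open>p = 0\<close>, the ray lands at \<open>0\<close>. Otherwise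
  a branch of the logarithm near \<open>p\<close> differs from the lift by a constant, so the lift stays bounded.
\<close>
lemma ex_ray_landing_or_bounded_lift:
  "\<exists>\<theta>. ray_lands \<phi> \<theta> 0 \<or> (\<exists>R. \<forall>x\<in>{-1<..<0}. norm (lift (Complex x \<theta>)) \<le> R)"
proof -
  define S where "S = {w. -1 < Re w \<and> Re w < 0 \<and> 0 < Im w \<and> Im w < 2 * pi}"
  define G where "G w = \<phi> (exp w)" for w
  have S: "open S" unfolding S_def
    by (intro open_Collect_conj open_halfspace_Re_lt open_halfspace_Re_gt open_halfspace_Im_gt open_halfspace_Im_lt)
  have G: "G holomorphic_on S" unfolding G_def
    by (rule holomorphic_on_subset[OF \<phi>_exp_holo]) (auto simp: S_def)
  have iG: "inj_on G S" unfolding G_def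
    by (rule inj_on_subset[OF inj_\<phi>_exp]) (auto simp: S_def)
  obtain C where C: "\<forall>z. exp (-2) \<le> norm z \<longrightarrow> norm z < 1 \<longrightarrow> norm (\<phi> z) \<le> C"
    using bounded_near_circle[of "exp (-2)"] by auto
  have GC: "norm (G w) \<le> C" if "-2 \<le> Re w" "Re w < 0" for w
    unfolding G_def using that by (intro C[rule_format]) (auto simp: norm_exp_eq_Re)
  have bG: "bounded (G ` S)"
    unfolding bounded_iff by (intro exI[of _ C]) (auto simp: S_def intro!: GC)
  obtain \<theta> where \<theta>: "\<theta> \<in> {0<..<2 * pi}" "(\<integral>\<^sup>+ x. energy_density S G x \<theta> \<partial>lborel) < \<infinity>"
    using almost_every_horizontal_finite_energy[OF S G iG bG, of 0 "2 * pi"] by auto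
  obtain p where p: "((\<lambda>x. G (Complex x \<theta>)) \<longlongrightarrow> p) (at_left 0)"
    using finite_energy_imp_limit[OF S G _ \<theta>(2), of "-1" 0] \<theta>(1) by (auto simp: S_def)
  show ?thesis
  proof (cases "p = 0")
    case True
    thus ?thesis using tendsto_horizontal_imp_ray_lands[of \<theta>] p by (auto simp: G_def)
  next
    case False
    have "\<forall>\<^sub>F x in at_left 0. dist (G (Complex x \<theta>)) p < norm p / 2"
      using p False by (intro tendstoD) auto
    then obtain b where b: "b < 0" "\<And>x. b < x \<Longrightarrow> x < 0 \<Longrightarrow> dist (G (Complex x \<theta>)) p < norm p / 2"
      using eventually_at_left[of "-1" "0::real"] by auto
    have cl: "continuous_on {..<0} (\<lambda>x. lift (Complex x \<theta>))"
      unfolding Complex_eq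
      by (intro continuous_on_compose2[OF holomorphic_on_imp_continuous_on[OF lift_holo]] continuous_intros) auto
    have near: "G (Complex x \<theta>) / p \<in> cball 1 (1/2)" if "x \<in> {b<..<0}" for x
    proof -
      have "norm (p - G (Complex x \<theta>)) / norm p \<le> 1 / 2"
        using b(2)[of x] that False by (simp add: dist_norm norm_minus_commute field_simps)
      moreover have "1 - G (Complex x \<theta>) / p = (p - G (Complex x \<theta>)) / p" using False by (simp add: field_simps)
      ultimately show ?thesis by (simp add: dist_norm norm_divide)
    qed
    have Ln: "continuous_on (cball 1 (1/2)) Ln"
    proof (intro continuous_on_Ln)
      fix z :: complex assume "z \<in> cball 1 (1/2)"
      hence "norm (1 - z) \<le> 1 / 2" by (simp add: dist_norm)
      hence "\<bar>Re (1 - z)\<bar> \<le> 1 / 2" using abs_Re_le_cmod order.trans by blast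
      thus "z \<notin> \<real>\<^sub>\<le>\<^sub>0" by (auto elim!: nonpos_Reals_cases)
    qed
    define g where "g x = lift (Complex x \<theta>) - Ln (G (Complex x \<theta>) / p)" for x
    have cg: "continuous_on {b<..<0} g"
      unfolding g_def
    proof (intro continuous_on_diff)
      show "continuous_on {b<..<0} (\<lambda>x. lift (Complex x \<theta>))"
        by (rule continuous_on_subset[OF cl]) auto
      have "continuous_on {b<..<0} (\<lambda>x. G (Complex x \<theta>) / p)"
        unfolding G_def Complex_eq using False
        by (intro continuous_intros continuous_on_compose2[OF holomorphic_on_imp_continuous_on[OF \<phi>_exp_holo]]) auto
      thus "continuous_on {b<..<0} (\<lambda>x. Ln (G (Complex x \<theta>) / p))"
        by (rule continuous_on_compose2[OF Ln]) (use near in blast)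
    qed
    have eg: "exp (g x) = p" if "x \<in> {b<..<0}" for x
    proof -
      have "G (Complex x \<theta>) / p \<noteq> 0" using near[OF that] by auto
      thus ?thesis using that exp_lift[of "Complex x \<theta>"] False by (simp add: g_def exp_diff G_def)
    qed
    \<comment> \<open>Two values of \<open>g\<close> differ by a multiple of \<open>2 pi i\<close>, and \<open>g\<close> is continuous.\<close>
    have "g constant_on {b<..<0}"
    proof (rule continuous_discrete_range_constant[OF _ cg])
      fix x assume x: "x \<in> {b<..<0}"
      have "2 * pi \<le> norm (g y - g x)" if "y \<in> {b<..<0}" "g y \<noteq> g x" for y
      proof (rule ccontr)
        assume "\<not> 2 * pi \<le> norm (g y - g x)"
        hence "\<bar>Im (g y) - Im (g x)\<bar> < 2 * pi" using abs_Im_le_cmod[of "g y - g x"] by simp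
        moreover have "exp (g y) = exp (g x)" using eg[OF x] eg[OF that(1)] by simp
        ultimately have "g y = g x" by (rule exp_complex_eqI)
        thus False using that(2) by simp
      qed
      thus "\<exists>e>0. \<forall>y. y \<in> {b<..<0} \<and> g y \<noteq> g x \<longrightarrow> e \<le> norm (g y - g x)"
        by (intro exI[of _ "2 * pi"]) simp
    qed simp
    then obtain g0 where g0: "\<And>x. x \<in> {b<..<0} \<Longrightarrow> g x = g0" unfolding constant_on_def by blast
    have "compact (Ln ` cball 1 (1/2))" by (intro compact_continuous_image Ln) simp
    hence "bounded (Ln ` cball 1 (1/2))" by (rule compact_imp_bounded)
    then obtain R0 where R0: "\<forall>z\<in>cball 1 (1/2). norm (Ln z) \<le> R0"
      unfolding bounded_iff by (metis imageI)
    have "norm (lift (Complex x \<theta>)) \<le> norm g0 + R0" if "x \<in> {b<..<0}" for x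
    proof -
      have "lift (Complex x \<theta>) = g0 + Ln (G (Complex x \<theta>) / p)" using g0[OF that] by (simp add: g_def diff_eq_eq)
      hence "norm (lift (Complex x \<theta>)) \<le> norm g0 + norm (Ln (G (Complex x \<theta>) / p))"
        by (simp only: norm_triangle_ineq)
      thus ?thesis using R0[rule_format, OF near[OF that]] by linarith
    qed
    then obtain R1 where R1: "\<forall>x\<in>{b<..<0}. norm (lift (Complex x \<theta>)) \<le> R1" by blast
    have "compact ((\<lambda>x. lift (Complex x \<theta>)) ` {-1..b})"
      using b(1) by (intro compact_continuous_image continuous_on_subset[OF cl]) auto
    hence "bounded ((\<lambda>x. lift (Complex x \<theta>)) ` {-1..b})" by (rule compact_imp_bounded)
    then obtain R2 where R2: "\<forall>x\<in>{-1..b}. norm (lift (Complex x \<theta>)) \<le> R2"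
      unfolding bounded_iff by (metis imageI)
    have "norm (lift (Complex x \<theta>)) \<le> max R1 R2" if "x \<in> {-1<..<0}" for x
      using R1 R2 that by (cases "x \<le> b") (auto simp: le_max_iff_disj)
    thus ?thesis by blast
  qed
qed

text \<open>
  The points of the level set \<open>{q = 0}\<close> at which \<open>norm (exp z) \<ge> \<epsilon>\<close> and that can be reached from near the imaginary
  axis form a compact set \<open>K\<close> off \<open>hat X\<close>. Its preimage under the lift is compact in the open half plane and
  therefore keeps a positive distance from \<open>i t\<close>.
\<close>
lemma small_on_level_set:
  fixes q :: "complex \<Rightarrow> real"
  assumes q: "continuous_on UNIV q" and qF: "\<And>z. z \<in> hat X \<Longrightarrow> q z \<noteq> 0"
    and qb: "\<And>a b. \<exists>Y. \<forall>z. a \<le> Re z \<longrightarrow> Re z \<le> b \<longrightarrow> q z = 0 \<longrightarrow> \<bar>Im z\<bar> \<le> Y"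
    and \<epsilon>: "\<epsilon> > 0"
  shows "\<exists>\<delta>>0. \<forall>w. Re w < 0 \<longrightarrow> q (lift w) = 0 \<longrightarrow> norm (w - Complex 0 t) < \<delta> \<longrightarrow> norm (\<phi> (exp w)) < \<epsilon>"
proof -
  obtain C where C: "C > 0" "\<forall>z. exp (-1) \<le> norm z \<longrightarrow> norm z < 1 \<longrightarrow> norm (\<phi> z) \<le> C"
    using bounded_near_circle[of "exp (-1)"] by auto
  have norm_lift: "norm (\<phi> (exp w)) = exp (Re (lift w))" if "Re w < 0" for w
    using exp_lift[OF that] by (metis norm_exp_eq_Re)
  obtain Y where Y: "\<forall>z. ln \<epsilon> \<le> Re z \<longrightarrow> Re z \<le> ln C \<longrightarrow> q z = 0 \<longrightarrow> \<bar>Im z\<bar> \<le> Y" using qb by blast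
  define K where "K = {z. ln \<epsilon> \<le> Re z \<and> Re z \<le> ln C \<and> q z = 0}"
  have "closed {z. q z = 0}" using q by (intro closed_Collect_eq) auto
  hence "closed K" unfolding K_def
    by (intro closed_Collect_conj closed_halfspace_Re_le closed_halfspace_Re_ge)
  moreover have "bounded K"
  proof -
    have "norm z \<le> (\<bar>ln \<epsilon>\<bar> + \<bar>ln C\<bar>) + Y" if "z \<in> K" for z
      using cmod_le[of z] that Y by (auto simp: K_def)
    thus ?thesis by (auto simp: bounded_iff)
  qed
  ultimately have "compact K" by (simp add: compact_eq_bounded_closed)
  hence "compact {w. Re w < 0 \<and> lift w \<in> K}"
    by (rule compact_lift_preimage) (use qF in \<open>auto simp: K_def\<close>)
  hence "open (- {w. Re w < 0 \<and> lift w \<in> K})" using compact_imp_closed by blast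
  moreover have "Complex 0 t \<in> - {w. Re w < 0 \<and> lift w \<in> K}" by simp
  ultimately obtain d where d: "d > 0" "ball (Complex 0 t) d \<subseteq> - {w. Re w < 0 \<and> lift w \<in> K}"
    using openE by blast
  show ?thesis
  proof (intro exI[of _ "min d 1"] conjI allI impI)
    show "0 < min d 1" using d by simp
    fix w assume w: "Re w < 0" "q (lift w) = 0" "norm (w - Complex 0 t) < min d 1"
    have "\<bar>Re w\<bar> < 1" using abs_Re_le_cmod[of "w - Complex 0 t"] w(3) by simp
    hence "norm (\<phi> (exp w)) \<le> C" using w(1) by (intro C(2)[rule_format]) (auto simp: norm_exp_eq_Re)
    hence "exp (Re (lift w)) \<le> C" using norm_lift[OF w(1)] by simp
    hence "Re (lift w) \<le> ln C" using C(1) by (simp add: ln_ge_iff)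
    moreover have "lift w \<notin> K" using d(2) w by (auto simp: dist_norm norm_minus_commute)
    ultimately have "Re (lift w) < ln \<epsilon>" using w(2) by (auto simp: K_def)
    hence "exp (Re (lift w)) < \<epsilon>" using \<epsilon> by (metis exp_less_cancel_iff exp_ln)
    thus "norm (\<phi> (exp w)) < \<epsilon>" using norm_lift[OF w(1)] by simp
  qed
qed

text \<open>
  In the coordinate \<open>\<zeta>\<close> with \<open>w = i t - exp \<zeta>\<close> the semicircles become vertical segments of height \<open>pi\<close>, and the
  half-line ending at \<open>i t\<close> becomes the real axis. On segments of small oscillation, smallness at one point gives
  smallness at the real point, and such segments occur within distance \<open>\<eta>\<close> of every real point far to the
  left. A Cauchy estimate on disks of radius \<open>1\<close>, which fit into the strip since \<open>1 < pi/2\<close>, controls the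
  change over the distance \<open>\<eta>\<close>.
\<close>
lemma ray_lands_if_semicircles_small:
  assumes sm: "\<And>\<epsilon>. \<epsilon> > 0 \<Longrightarrow> \<exists>\<delta>>0. \<forall>\<rho>\<in>{0<..<\<delta>}. \<exists>y\<in>{-(pi/2)<..<pi/2}.
      norm (\<phi> (exp (Complex 0 t - of_real \<rho> * cis y))) < \<epsilon>"
  shows "ray_lands \<phi> t 0"
proof -
  define b where "b = ln (1/4::real)"
  define S where "S = {z. Re z < b \<and> -(pi/2) < Im z \<and> Im z < pi/2}"
  define E where "E z = \<phi> (exp (Complex 0 t - exp z))" for z
  have S: "open S" unfolding S_def
    by (intro open_Collect_conj open_halfspace_Re_lt open_halfspace_Im_gt open_halfspace_Im_lt)
  have nS: "norm (exp z) < 1/4" if "z \<in> S" for z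
  proof -
    have "exp (Re z) < exp b" using that by (simp add: S_def)
    thus ?thesis by (simp add: b_def norm_exp_eq_Re)
  qed
  have reS: "-1 < Re (Complex 0 t - exp z) \<and> Re (Complex 0 t - exp z) < 0" if "z \<in> S" for z
  proof -
    have "0 < cos (Im z)" using that by (intro cos_gt_zero_pi) (auto simp: S_def)
    moreover have "\<bar>Re (exp z)\<bar> < 1/4" using abs_Re_le_cmod[of "exp z"] nS[OF that] by linarith
    ultimately show ?thesis by (auto simp: Re_exp)
  qed
  have hE: "E holomorphic_on S" unfolding E_def
    by (rule holomorphic_on_compose_gen[OF _ \<phi>_exp_holo, unfolded o_def])
       (use reS in \<open>auto intro!: holomorphic_intros\<close>)
  have iE: "inj_on E S"
  proof (rule inj_onI)
    fix z w assume zw: "z \<in> S" "w \<in> S" "E z = E w"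
    have "exp (Complex 0 t - exp z) = exp (Complex 0 t - exp w)"
      using inj_onD[OF inj zw(3)[unfolded E_def]] reS[OF zw(1)] reS[OF zw(2)] by (simp del: minus_complex.sel)
    moreover have "\<bar>Im (Complex 0 t - exp z) - Im (Complex 0 t - exp w)\<bar> < 2 * pi"
    proof -
      have "\<bar>Im (exp z)\<bar> < 1/4" "\<bar>Im (exp w)\<bar> < 1/4"
        using abs_Im_le_cmod nS[OF zw(1)] nS[OF zw(2)] le_less_trans by blast+
      moreover have "Im (Complex 0 t - exp z) - Im (Complex 0 t - exp w) = Im (exp w) - Im (exp z)" by simp
      ultimately show ?thesis using pi_gt3 by linarith
    qed
    ultimately have "Complex 0 t - exp z = Complex 0 t - exp w" by (rule exp_complex_eqI[rotated])
    hence "exp z = exp w" by simp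
    moreover have "\<bar>Im z - Im w\<bar> < 2 * pi" using zw(1,2) by (auto simp: S_def abs_less_iff)
    ultimately show "z = w" by (rule exp_complex_eqI[rotated])
  qed
  obtain C where C: "C > 0" "\<forall>z. exp (-1) \<le> norm z \<longrightarrow> norm z < 1 \<longrightarrow> norm (\<phi> z) \<le> C"
    using bounded_near_circle[of "exp (-1)"] by auto
  have EC: "norm (E z) \<le> C" if "z \<in> S" for z
    unfolding E_def using reS[OF that] by (intro C(2)[rule_format]) (auto simp: norm_exp_eq_Re)
  have bE: "bounded (E ` S)" unfolding bounded_iff using EC by (intro exI[of _ C]) auto
  have small: "\<forall>\<^sub>F x in at_bot. norm (E (of_real x)) < \<epsilon>" if \<epsilon>: "\<epsilon> > 0" for \<epsilon>
  proof -
    define \<epsilon>' where "\<epsilon>' = \<epsilon> / 4"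
    have \<epsilon>': "\<epsilon>' > 0" using \<epsilon> by (simp add: \<epsilon>'_def)
    obtain \<delta> where \<delta>: "\<delta> > 0" "\<And>\<rho>. \<rho> \<in> {0<..<\<delta>} \<Longrightarrow> \<exists>y\<in>{-(pi/2)<..<pi/2}.
      norm (\<phi> (exp (Complex 0 t - of_real \<rho> * cis y))) < \<epsilon>'" using sm[OF \<epsilon>'] by blast
    \<comment> \<open>\<open>C\<close> bounds the derivative on the real axis, so a step of length \<open>\<eta>\<close> changes \<open>E\<close> by at most \<open>\<epsilon>'\<close>.\<close>
    define \<eta> where "\<eta> = min 1 (\<epsilon>' / C)"
    have \<eta>: "\<eta> > 0" "\<eta> \<le> 1" "C * \<eta> \<le> \<epsilon>'" using \<epsilon>' C(1) by (auto simp: \<eta>_def min_def field_simps)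
    have "\<forall>\<^sub>F x in at_bot. \<exists>u\<in>{x-\<eta>..x}. \<forall>y\<in>{-(pi/2)<..<pi/2}. \<forall>y'\<in>{-(pi/2)<..<pi/2}. norm (E (Complex u y) - E (Complex u y')) < \<epsilon>'"
      by (rule small_vertical_oscillation[OF _ S_def hE iE bE \<epsilon>' \<eta>(1)]) simp
    moreover have "\<forall>\<^sub>F x in at_bot. x < min (ln \<delta>) (b - 1)" by (rule eventually_gt_at_bot)
    ultimately show ?thesis
    proof eventually_elim
      case (elim x)
      then obtain u where u: "u \<in> {x-\<eta>..x}"
        and osc: "\<And>y y'. y \<in> {-(pi/2)<..<pi/2} \<Longrightarrow> y' \<in> {-(pi/2)<..<pi/2} \<Longrightarrow> norm (E (Complex u y) - E (Complex u y')) < \<epsilon>'"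
        by blast
      have "exp u < \<delta>" using u elim(2) \<delta>(1) by (metis atLeastAtMost_iff exp_less_cancel_iff exp_ln le_less_trans min_less_iff_conj)
      then obtain y where y: "y \<in> {-(pi/2)<..<pi/2}" "norm (\<phi> (exp (Complex 0 t - of_real (exp u) * cis y))) < \<epsilon>'"
        using \<delta>(2)[of "exp u"] by auto
      have "of_real (exp u) * cis y = exp (Complex u y)" by (simp add: exp_eq_polar)
      hence Ey: "norm (E (Complex u y)) < \<epsilon>'" using y(2) by (simp add: E_def)
      have "norm (E (Complex u 0)) \<le> norm (E (Complex u 0) - E (Complex u y)) + norm (E (Complex u y))"
        by (metis diff_add_cancel norm_triangle_ineq)
      also have "\<dots> < 2 * \<epsilon>'" using osc[of 0 y] y(1) Ey by simp
      finally have Eu: "norm (E (Complex u 0)) < 2 * \<epsilon>'" .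
      have d: "norm (deriv E z) \<le> C" if z: "z \<in> closed_segment (of_real u) (of_real x)" for z
      proof -
        have z': "z = of_real (Re z)" "Re z \<le> x"
        proof -
          have "z \<in> of_real ` closed_segment u x" using z by (simp add: closed_segment_of_real)
          thus "z = of_real (Re z)" "Re z \<le> x" using u by (auto simp: closed_segment_eq_real_ivl)
        qed
        have cb: "cball z 1 \<subseteq> S"
        proof
          fix w assume "w \<in> cball z 1"
          hence "norm (w - z) \<le> 1" by (simp add: dist_norm norm_minus_commute)
          hence "\<bar>Re w - Re z\<bar> \<le> 1" "\<bar>Im w - Im z\<bar> \<le> 1"
            using abs_Re_le_cmod[of "w - z"] abs_Im_le_cmod[of "w - z"] by simp_all
          moreover have "Im z = 0" using z'(1) by (metis Im_complex_of_real)
          ultimately show "w \<in> S" using z'(2) elim(2) pi_gt3 by (auto simp: S_def)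
        qed
        have "norm ((deriv ^^ 1) E z) \<le> fact 1 * C / 1 ^ 1"
        proof (rule Cauchy_inequality)
          show "E holomorphic_on ball z 1" using cb by (intro holomorphic_on_subset[OF hE]) (meson ball_subset_cball order.trans)
          show "continuous_on (cball z 1) E" using cb holomorphic_on_imp_continuous_on[OF hE] continuous_on_subset by blast
          show "norm (E w) \<le> C" if "norm (z - w) = 1" for w
            using cb that by (intro EC) (auto simp: dist_norm subset_iff)
        qed simp
        thus ?thesis by simp
      qed
      have "norm (E (of_real x) - E (of_real u)) \<le> C * norm (complex_of_real x - of_real u)"
      proof (rule field_differentiable_bound[of "closed_segment (of_real u) (of_real x)" E "deriv E"])
        fix z assume z: "z \<in> closed_segment (complex_of_real u) (of_real x)"
        have "z \<in> of_real ` closed_segment u x" using z by (simp add: closed_segment_of_real)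
        hence "z \<in> S" using u elim(2) by (auto simp: closed_segment_eq_real_ivl S_def)
        thus "(E has_field_derivative deriv E z) (at z within closed_segment (of_real u) (of_real x))"
          using holomorphic_derivI[OF hE S] has_field_derivative_at_within by blast
        show "norm (deriv E z) \<le> C" by (rule d[OF z])
      qed auto
      also have "\<dots> = C * (x - u)" using u by (simp flip: of_real_diff)
      also have "\<dots> \<le> C * \<eta>" using u C(1) by (intro mult_left_mono) auto
      finally have "norm (E (of_real x) - E (of_real u)) \<le> \<epsilon>'" using \<eta>(3) by simp
      moreover have "norm (E (of_real x)) \<le> norm (E (of_real x) - E (of_real u)) + norm (E (of_real u))"
        by (metis diff_add_cancel norm_triangle_ineq)
      moreover have "complex_of_real u = Complex u 0" by (simp add: complex_eq_iff)
      ultimately show ?case using Eu \<epsilon>' by (simp add: \<epsilon>'_def)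
    qed
  qed
  show ?thesis
  proof (rule tendsto_horizontal_imp_ray_lands, rule tendstoI)
    fix \<epsilon> :: real assume "\<epsilon> > 0"
    then obtain x0 where x0: "\<And>x. x \<le> x0 \<Longrightarrow> norm (E (of_real x)) < \<epsilon>"
      using small unfolding eventually_at_bot_linorder by blast
    show "\<forall>\<^sub>F x in at_left 0. dist (\<phi> (exp (Complex x t))) 0 < \<epsilon>"
    proof (rule eventually_mono)
      show "\<forall>\<^sub>F x in at_left 0. x \<in> {- exp x0<..<0}" by (rule eventually_at_left_real) simp
      fix x assume x: "x \<in> {- exp x0<..<0}"
      have "ln (- x) \<le> x0" using x by (metis exp_ln greaterThanLessThan_iff ln_exp ln_le_cancel_iff less_imp_le minus_less_iff neg_0_less_iff_less exp_gt_zero)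
      moreover have "Complex 0 t - exp (of_real (ln (- x))) = Complex x t"
      proof -
        have "exp (complex_of_real (ln (- x))) = of_real (- x)" using x unfolding exp_of_real by simp
        thus ?thesis by (simp add: complex_eq_iff)
      qed
      ultimately show "dist (\<phi> (exp (Complex x t))) 0 < \<epsilon>"
        using x0[of "ln (- x)"] by (simp add: E_def)
    qed
  qed
qed

text \<open>
  The crossing lemma is applied to \<open>q \<circ> lift\<close>, where \<open>q\<close> compares the distances to \<open>A\<close> and \<open>B\<close>. The barriers are
  two translates of a half-line on which the lift is bounded: translating by \<open>2 pi i N\<close> moves the image by
  \<open>- 2 pi i N\<close>, into the region where \<open>B\<close> is nearer, and the opposite translation moves it to where \<open>A\<close> is nearer.
\<close>
theorem landing_ray_if_separated:
  assumes AB: "hat X = A \<union> B" "A \<inter> B = {}" "closed A" "closed B" "A \<noteq> {}" "B \<noteq> {}"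
    and hB: "\<And>x. \<exists>y. \<forall>z\<in>B. x \<le> Re z \<longrightarrow> Im z < y"
    and hA: "\<And>x. \<exists>y. \<forall>z\<in>A. x \<le> Re z \<longrightarrow> y < Im z"
  shows "\<exists>\<theta>. ray_lands \<phi> \<theta> 0"
proof -
  obtain v where v: "ray_lands \<phi> v 0 \<or> (\<exists>R. \<forall>x\<in>{-1<..<0}. norm (lift (Complex x v)) \<le> R)"
    using ex_ray_landing_or_bounded_lift by blast
  show ?thesis
  proof (cases "ray_lands \<phi> v 0")
    case False
    then obtain R where R: "\<And>x. x \<in> {-1<..<0} \<Longrightarrow> norm (lift (Complex x v)) \<le> R" using v by blast
    define q where "q z = infdist z A - infdist z B" for z
    have q: "continuous_on UNIV q" unfolding q_def[abs_def] by (intro continuous_intros)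
    have per: "z + 2 * of_int n * of_real pi * \<i> \<in> hat X" if "z \<in> hat X" for z n
    proof -
      have "exp (z + 2 * of_int n * of_real pi * \<i>) = exp z"
        unfolding exp_add using exp_integer_2pi[of "of_int n"] by (simp add: mult_ac)
      thus ?thesis using that by (simp add: hat_def)
    qed
    have neg: "\<exists>Y. \<forall>z. a \<le> Re z \<longrightarrow> Re z \<le> b \<longrightarrow> Y \<le> Im z \<longrightarrow> q z < 0" for a b
      using nearer_part_far_out[of A B 1 a b] per AB hB by (simp add: q_def)
    have pos: "\<exists>Y. \<forall>z. a \<le> Re z \<longrightarrow> Re z \<le> b \<longrightarrow> Im z \<le> Y \<longrightarrow> 0 < q z" for a b
    proof -
      have hA': "\<exists>y. \<forall>z\<in>A. x \<le> Re z \<longrightarrow> -1 * Im z < y" for x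
        using hA[of x] by (metis minus_less_iff minus_minus mult_minus1)
      have "\<exists>Y. \<forall>z. a \<le> Re z \<longrightarrow> Re z \<le> b \<longrightarrow> Y \<le> -1 * Im z \<longrightarrow> infdist z B < infdist z A"
        by (rule nearer_part_far_out) (use per AB hA' in \<open>auto simp: Un_commute\<close>)
      then obtain Y where "\<forall>z. a \<le> Re z \<longrightarrow> Re z \<le> b \<longrightarrow> Y \<le> -1 * Im z \<longrightarrow> infdist z B < infdist z A" ..
      thus ?thesis by (intro exI[of _ "-Y"]) (auto simp: q_def)
    qed
    have qF: "q z \<noteq> 0" if "z \<in> hat X" for z
      using that AB in_closed_iff_infdist_zero[of A z] in_closed_iff_infdist_zero[of B z] by (auto simp: q_def)
    have qb: "\<exists>Y. \<forall>z. a \<le> Re z \<longrightarrow> Re z \<le> b \<longrightarrow> q z = 0 \<longrightarrow> \<bar>Im z\<bar> \<le> Y" for a b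
    proof -
      obtain Y1 where Y1: "\<And>z. a \<le> Re z \<Longrightarrow> Re z \<le> b \<Longrightarrow> Y1 \<le> Im z \<Longrightarrow> q z < 0" using neg by blast
      obtain Y2 where Y2: "\<And>z. a \<le> Re z \<Longrightarrow> Re z \<le> b \<Longrightarrow> Im z \<le> Y2 \<Longrightarrow> 0 < q z" using pos by blast
      have "\<bar>Im z\<bar> \<le> \<bar>Y1\<bar> + \<bar>Y2\<bar>" if "a \<le> Re z" "Re z \<le> b" "q z = 0" for z
        using Y1[OF that(1,2)] Y2[OF that(1,2)] that(3) by linarith
      thus ?thesis by blast
    qed
    obtain Y1 where Y1: "\<And>z. -R \<le> Re z \<Longrightarrow> Re z \<le> R \<Longrightarrow> Y1 \<le> Im z \<Longrightarrow> q z < 0" using neg by blast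
    obtain Y2 where Y2: "\<And>z. -R \<le> Re z \<Longrightarrow> Re z \<le> R \<Longrightarrow> Im z \<le> Y2 \<Longrightarrow> 0 < q z" using pos by blast
    obtain N :: nat where N: "(R + \<bar>Y1\<bar> + \<bar>Y2\<bar> + 1) / (2 * pi) < real N" using reals_Archimedean2 by blast
    hence N': "R + \<bar>Y1\<bar> + \<bar>Y2\<bar> + 1 < 2 * real N * pi" by (simp add: pos_divide_less_eq mult_ac)
    have "norm (lift (Complex (-1/2) v)) \<le> R" by (rule R) simp
    hence R0: "0 \<le> R" using norm_ge_zero order.trans by blast
    have shift: "lift (Complex u (v + 2 * of_int n * pi)) = lift (Complex u v) - 2 * of_int n * of_real pi * \<i>" for u n
    proof -
      have "Complex u (v + 2 * of_int n * pi) = Complex u v + 2 * of_int n * of_real pi * \<i>" by (simp add: complex_eq_iff)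
      thus ?thesis by (simp only: lift_shift)
    qed
    have bd: "\<bar>Re (lift (Complex u v))\<bar> \<le> R \<and> \<bar>Im (lift (Complex u v))\<bar> \<le> R" if "-1 < u" "u < 0" for u
      using R[of u] that abs_Re_le_cmod[of "lift (Complex u v)"] abs_Im_le_cmod[of "lift (Complex u v)"] by auto
    have "\<exists>t. \<forall>\<rho>\<in>{0<..<1/4}. \<exists>y\<in>{-(pi/2)<..<pi/2}. q (lift (Complex 0 t - of_real \<rho> * cis y)) = 0"
    proof (rule ex_point_with_crossing_semicircles)
      show "continuous_on {w. -1 < Re w \<and> Re w < 0} (\<lambda>w. q (lift w))"
        by (rule continuous_on_compose2[OF q continuous_on_subset[OF holomorphic_on_imp_continuous_on[OF lift_holo]]]) auto
      have "0 < 2 * real N * pi" using N' R0 by linarith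
      thus "v + 2 * of_int (- int N) * pi < v + 2 * of_int (int N) * pi" by simp
      show "q (lift (Complex u (v + 2 * of_int (- int N) * pi))) < 0" if "-1 < u" "u < 0" for u
        unfolding shift using bd[OF that] N' by (intro Y1) auto
      show "0 < q (lift (Complex u (v + 2 * of_int (int N) * pi)))" if "-1 < u" "u < 0" for u
        unfolding shift using bd[OF that] N' by (intro Y2) auto
    qed
    then obtain t where t: "\<And>\<rho>. \<rho> \<in> {0<..<1/4} \<Longrightarrow> \<exists>y\<in>{-(pi/2)<..<pi/2}. q (lift (Complex 0 t - of_real \<rho> * cis y)) = 0"
      by blast
    have "ray_lands \<phi> t 0"
    proof (rule ray_lands_if_semicircles_small)
      fix \<epsilon> :: real assume "\<epsilon> > 0"
      then obtain \<delta> where \<delta>: "\<delta> > 0" "\<And>w. Re w < 0 \<Longrightarrow> q (lift w) = 0 \<Longrightarrow> norm (w - Complex 0 t) < \<delta> \<Longrightarrow> norm (\<phi> (exp w)) < \<epsilon>"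
        using small_on_level_set[OF q qF qb] by metis
      show "\<exists>\<delta>>0. \<forall>\<rho>\<in>{0<..<\<delta>}. \<exists>y\<in>{-(pi/2)<..<pi/2}. norm (\<phi> (exp (Complex 0 t - of_real \<rho> * cis y))) < \<epsilon>"
      proof (intro exI[of _ "min \<delta> (1/4)"] conjI ballI)
        show "0 < min \<delta> (1/4)" using \<delta>(1) by simp
        fix \<rho> assume \<rho>: "\<rho> \<in> {0<..<min \<delta> (1/4)}"
        then obtain y where y: "y \<in> {-(pi/2)<..<pi/2}" "q (lift (Complex 0 t - of_real \<rho> * cis y)) = 0"
          using t[of \<rho>] by auto
        have "0 < cos y" using y(1) by (intro cos_gt_zero_pi) auto
        hence "norm (\<phi> (exp (Complex 0 t - of_real \<rho> * cis y))) < \<epsilon>"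
          using \<rho> by (intro \<delta>(2) y(2)) (auto simp: norm_mult)
        thus "\<exists>y\<in>{-(pi/2)<..<pi/2}. norm (\<phi> (exp (Complex 0 t - of_real \<rho> * cis y))) < \<epsilon>"
          using y(1) by blast
      qed
    qed
    thus ?thesis by blast
  qed blast
qed
end

section \<open>From a landing ray to a slit plane\<close>

context exterior_map begin

text \<open>
  Run along the ray backwards, from its landing point \<open>0\<close> to a point where \<open>norm \<phi> > \<rho>\<close>, and stop when the circle of
  radius \<open>\<rho>\<close> is first met.
\<close>
lemma end_of_landing_ray:
  assumes land: "ray_lands \<phi> \<theta> 0" and \<rho>: "0 < \<rho>"
  obtains J where "arc J" "pathstart J = 0" "norm (pathfinish J) = \<rho>"
    "\<And>t. t \<in> {0..1} \<Longrightarrow> t \<noteq> 1 \<Longrightarrow> norm (J t) < \<rho>" "path_image J \<inter> X \<subseteq> {0}"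
proof -
  define g where "g r = \<phi> (rcis r \<theta>)" for r
  have gX: "g r \<notin> X" if "0 < r" "r < 1" for r
    using in_exterior[of "rcis r \<theta>"] that by (simp add: g_def)
  have gcont: "isCont g r" if "0 < r" "r < 1" for r
  proof -
    have "isCont \<phi> (rcis r \<theta>)"
      using holomorphic_on_imp_continuous_on[OF holo] that
        continuous_on_eq_continuous_at[of "ball 0 1 - {0::complex}" \<phi>]
      by (simp add: open_Diff)
    moreover have "isCont (\<lambda>r. rcis r \<theta>) r" unfolding rcis_def by (intro continuous_intros)
    ultimately show ?thesis unfolding g_def by (rule isCont_o2[rotated])
  qed
  have ginj: "r = r'" if r: "0 < r" "r < 1" "0 < r'" "r' < 1" "g r = g r'" for r r'
  proof -
    have "rcis r \<theta> = rcis r' \<theta>" using inj_onD[OF inj] r by (simp add: g_def)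
    hence "norm (rcis r \<theta>) = norm (rcis r' \<theta>)" by (rule arg_cong)
    thus ?thesis using r by simp
  qed
  have glim: "(g \<longlongrightarrow> 0) (at_left 1)" using land unfolding ray_lands_iff_tendsto g_def .
  have "\<forall>\<^sub>F z in at 0. \<rho> < norm (\<phi> z)"
    using filterlim_at_infinity_imp_norm_at_top[OF pole[unfolded is_pole_def]]
    by (simp add: filterlim_at_top_dense)
  then obtain e where e: "e > 0" "\<And>z. z \<noteq> 0 \<Longrightarrow> dist z 0 < e \<Longrightarrow> \<rho> < norm (\<phi> z)"
    unfolding eventually_at by blast
  define a where "a = min (e / 2) (1 / 2)"
  have a: "0 < a" "a < 1" "a < e" using e(1) by (auto simp: a_def)
  have ga: "\<rho> < norm (g a)" unfolding g_def using a by (intro e(2)) auto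
  \<comment> \<open>The ray from radius \<open>1\<close> down to radius \<open>a\<close>, closed up by its limit \<open>0\<close>.\<close>
  define \<gamma> where "\<gamma> s = (if s = 0 then 0 else g (1 - s * (1 - a)))" for s
  have s01: "0 < 1 - s * (1 - a) \<and> 1 - s * (1 - a) < 1" if s: "0 < s" "s \<le> 1" for s
  proof -
    define k where "k = s * (1 - a)"
    have "k \<le> 1 * (1 - a)" unfolding k_def using s a by (intro mult_right_mono) auto
    moreover have "0 < k" using s a by (simp add: k_def)
    ultimately show ?thesis unfolding k_def[symmetric] using a by auto
  qed
  have \<gamma>0: "\<gamma> 0 = 0" and \<gamma>1: "\<gamma> 1 = g a" by (simp_all add: \<gamma>_def)
  have path\<gamma>: "path \<gamma>" unfolding path_def continuous_on_def
  proof
    fix s :: real assume s: "s \<in> {0..1}"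
    show "(\<gamma> \<longlongrightarrow> \<gamma> s) (at s within {0..1})"
    proof (cases "s = 0")
      case True
      have "filterlim (\<lambda>s. 1 - s * (1 - a)) (at_left 1) (at 0 within {0..1})"
        unfolding filterlim_at
      proof
        show "\<forall>\<^sub>F s in at 0 within {0..1}. 1 - s * (1 - a) \<in> {..<1} \<and> 1 - s * (1 - a) \<noteq> 1"
          unfolding eventually_at_filter using a by (intro always_eventually) auto
        show "((\<lambda>s. 1 - s * (1 - a)) \<longlongrightarrow> 1) (at 0 within {0..1})"
          by (auto intro!: tendsto_eq_intros)
      qed
      hence "((\<lambda>s. g (1 - s * (1 - a))) \<longlongrightarrow> 0) (at 0 within {0..1})"
        by (rule filterlim_compose[OF glim])
      moreover have "\<forall>\<^sub>F s in at 0 within {0..1}. g (1 - s * (1 - a)) = \<gamma> s"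
        unfolding eventually_at_filter by (intro always_eventually) (auto simp: \<gamma>_def)
      ultimately have "(\<gamma> \<longlongrightarrow> 0) (at 0 within {0..1})" by (rule Lim_transform_eventually)
      thus ?thesis using True \<gamma>0 by simp
    next
      case False
      hence s': "0 < s" "s \<le> 1" using s by auto
      have "isCont (\<lambda>s. g (1 - s * (1 - a))) s"
        by (rule isCont_o2[OF _ gcont]) (use s01[OF s'] in \<open>auto intro!: continuous_intros\<close>)
      hence "((\<lambda>s. g (1 - s * (1 - a))) \<longlongrightarrow> \<gamma> s) (at s)" using False by (simp add: isCont_def \<gamma>_def)
      moreover have "\<forall>\<^sub>F s in at s. g (1 - s * (1 - a)) = \<gamma> s"
      proof (rule eventually_mono)
        show "\<forall>\<^sub>F s' in at s. s' \<in> {0<..} - {s}" using s' by (intro eventually_at_in_open) auto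
      qed (simp add: \<gamma>_def)
      ultimately have "(\<gamma> \<longlongrightarrow> \<gamma> s) (at s)" by (rule Lim_transform_eventually)
      thus ?thesis by (rule tendsto_within_subset) simp
    qed
  qed
  have \<gamma>X: "\<gamma> s \<notin> X" if "0 < s" "s \<le> 1" for s using gX s01[OF that] that by (simp add: \<gamma>_def)
  have arc\<gamma>: "arc \<gamma>" unfolding arc_def
  proof (intro conjI path\<gamma> inj_onI)
    fix s s' assume s: "s \<in> {0..1}" "s' \<in> {0..1}" "\<gamma> s = \<gamma> s'"
    show "s = s'"
    proof (cases "s = 0 \<or> s' = 0")
      case True
      thus ?thesis using \<gamma>X[of s] \<gamma>X[of s'] zero \<gamma>0 s by (metis atLeastAtMost_iff order_le_less)
    next
      case False
      hence s': "0 < s" "s \<le> 1" "0 < s'" "s' \<le> 1" using s by auto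
      hence "1 - s * (1 - a) = 1 - s' * (1 - a)"
        using s(3) s01[of s] s01[of s'] by (intro ginj) (auto simp: \<gamma>_def)
      thus ?thesis using a by simp
    qed
  qed
  have "pathfinish \<gamma> \<notin> ball 0 \<rho>" using \<gamma>1 ga by (simp add: pathfinish_def)
  then obtain u where u: "0 \<le> u" "u \<le> 1" "\<And>x. 0 \<le> x \<and> x < u \<Longrightarrow> \<gamma> x \<in> interior (ball 0 \<rho>)"
     "\<gamma> u \<notin> interior (ball 0 \<rho>)" "u = 0 \<or> \<gamma> u \<in> closure (ball 0 \<rho>)"
    using subpath_to_frontier_explicit[OF path\<gamma>] by metis
  have u0: "u \<noteq> 0" using u(4) \<gamma>0 \<rho> by auto
  hence nu: "norm (\<gamma> u) = \<rho>" using u(4,5) \<rho> by auto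
  define J where "J = subpath 0 u \<gamma>"
  have J: "J t = \<gamma> (u * t)" for t by (simp add: J_def subpath_def)
  show ?thesis
  proof
    show "arc J" unfolding J_def using u u0 by (intro arc_subpath_arc arc\<gamma>) auto
    show "pathstart J = 0" "norm (pathfinish J) = \<rho>" using \<gamma>0 nu by (simp_all add: pathstart_def pathfinish_def J)
    show "norm (J t) < \<rho>" if "t \<in> {0..1}" "t \<noteq> 1" for t
    proof -
      have "u * t < u * 1" using that u(1) u0 by (intro mult_strict_left_mono) auto
      thus ?thesis using u(3)[of "u * t"] u(1) that by (simp add: J)
    qed
    show "path_image J \<inter> X \<subseteq> {0}"
    proof
      fix z assume z: "z \<in> path_image J \<inter> X"
      then obtain t where t: "t \<in> {0..1}" "z = \<gamma> (u * t)" by (auto simp: path_image_def J)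
      have "u * t \<le> 1" using t(1) u(1,2) mult_le_one[of u t] by auto
      hence "u * t = 0" using \<gamma>X[of "u * t"] t z u(1) by (cases "u * t = 0") auto
      hence "z = \<gamma> 0" using t(2) by (simp only:)
      thus "z \<in> {0}" using \<gamma>0 by simp
    qed
  qed
qed

end

lemma closed_outer_ray:
  fixes p :: complex assumes "p \<noteq> 0"
  shows "closed ((\<lambda>t. of_real t * p) ` {1..})"
proof -
  have "(\<lambda>t. of_real t * p) ` {1..} = {z. Im (z / p) = 0} \<inter> {z. 1 \<le> Re (z / p)}"
  proof -
    have "z \<in> (\<lambda>t. of_real t * p) ` {1..}" if "Im (z / p) = 0" "1 \<le> Re (z / p)" for z
    proof -
      have "z / p = of_real (Re (z / p))" using that(1) by (simp add: complex_eq_iff)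
      hence "z = of_real (Re (z / p)) * p" using assms by (metis nonzero_divide_eq_eq)
      thus ?thesis using that(2) by (intro image_eqI) auto
    qed
    moreover have "Im (of_real t * p / p) = 0 \<and> 1 \<le> Re (of_real t * p / p)" if "1 \<le> t" for t
      using assms that by simp
    ultimately show ?thesis by blast
  qed
  moreover have "closed \<dots>"
    using assms by (intro closed_Int closed_Collect_eq closed_Collect_le continuous_intros) auto
  ultimately show ?thesis by simp
qed

text \<open>
  The Moebius transformation \<open>m z = 1 / (z + p)\<close> sends \<open>J\<close> and the outer ray, completed by \<open>\<infinity>\<close>, to a compact
  arc, because its pole \<open>- p\<close> lies off both. An arc does not separate the plane, so \<open>S\<close> is connected; it is simply
  connected because its complement is connected and unbounded. The part of \<open>S\<close> in the closed disk is
  a retract of \<open>S\<close>: as the slit is radial outside the disk, the radial projection onto the circle avoids it.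
\<close>
lemma slit_plane:
  fixes J :: "real \<Rightarrow> complex" and p :: complex
  defines "S \<equiv> - (path_image J \<union> (\<lambda>t. of_real t * p) ` {1..})"
  assumes J: "arc J" "pathstart J = 0" "pathfinish J = p" and p: "p \<noteq> 0"
    and inside: "\<And>t. t \<in> {0..1} \<Longrightarrow> t \<noteq> 1 \<Longrightarrow> norm (J t) < norm p"
  shows "open S" "simply_connected S" "path_connected (S \<inter> cball 0 (norm p))"
    "sphere 0 (norm p) - {p} \<subseteq> S"
proof -
  define R where "R = (\<lambda>t. of_real t * p) ` {1..}"
  have S: "S = - (path_image J \<union> R)" by (simp add: S_def R_def)
  have J1: "J 1 = p" using J by (simp add: pathfinish_def)
  have Jn: "z = p \<or> norm z < norm p" if z: "z \<in> path_image J" for z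
  proof -
    obtain t where "t \<in> {0..1}" "z = J t" using z by (auto simp: path_image_def)
    thus ?thesis using inside[of t] J1 by (cases "t = 1") auto
  qed
  have Rn: "\<exists>t\<ge>1. z = of_real t * p" if "z \<in> R" for z using that by (auto simp: R_def)
  have Rn': "z = p \<or> norm p < norm z" if z: "z \<in> R" for z
  proof -
    obtain t where t: "t \<ge> 1" "z = of_real t * p" using Rn[OF z] by blast
    show ?thesis using t p by (cases "t = 1") (auto simp: norm_mult)
  qed
  show op: "open S" unfolding S_def
    using closed_outer_ray[OF p] closed_path_image[OF arc_imp_path[OF J(1)]] by (intro open_Compl closed_Un)
  show sph: "sphere 0 (norm p) - {p} \<subseteq> S" unfolding S using Jn Rn' by fastforce
  have mpS: "-p \<in> S"
  proof -
    have "-p \<noteq> p" using p by (simp add: minus_equation_iff complex_eq_iff)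
    thus ?thesis using sph by auto
  qed
  \<comment> \<open>\<open>m\<close> maps the outer ray to the half-open segment from \<open>1 / (2 p)\<close> to \<open>0\<close>, the image of \<open>\<infinity>\<close>.\<close>
  define m where "m z = inverse (z + p)" for z
  define T where "T = (m \<circ> J) +++ linepath (inverse (2 * p)) 0"
  have nz: "z + p \<noteq> 0" if "z \<in> path_image J \<union> R" for z
    using that mpS unfolding S by (metis ComplD add_eq_0_iff2)
  have inv_m: "inverse (m z) - p = z" for z by (simp add: m_def)
  have m_inv: "m (inverse w - p) = w" for w by (simp add: m_def)
  have seg_R: "inverse w - p \<in> R" if w: "w \<in> closed_segment (inverse (2 * p)) 0" "w \<noteq> 0" for w
  proof -
    obtain u where u: "0 \<le> u" "u \<le> 1" "w = (1 - u) *\<^sub>R inverse (2 * p)" using w(1) by (auto simp: closed_segment_def)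
    have u1: "u < 1" using u w(2) by (cases "u = 1") auto
    define t where "t = 2 / (1 - u) - 1"
    have "inverse w - p = of_real t * p"
      using u1 p unfolding u(3) t_def by (simp add: scaleR_conv_of_real field_simps)
    moreover have "1 \<le> t" using u u1 by (simp add: t_def field_simps)
    ultimately show ?thesis unfolding R_def by auto
  qed
  have R_seg: "m z \<in> closed_segment (inverse (2 * p)) 0" if z: "z \<in> R" for z
  proof -
    obtain t where t: "t \<ge> 1" "z = of_real t * p" using Rn[OF z] by blast
    have tp: "complex_of_real t * p + p = of_real (t + 1) * p" by (simp add: algebra_simps)
    define k where "k = t + 1"
    have "m z = inverse (of_real t * p + p)" unfolding m_def t(2) by (rule refl)
    also have "of_real t * p + p = of_real k * p" unfolding k_def by (rule tp)
    finally have "m z = inverse (of_real k * p)" .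
    also have "\<dots> = (2 / k) *\<^sub>R inverse (2 * p)"
      unfolding scaleR_conv_of_real using t(1) p by (simp add: k_def inverse_eq_divide)
    also have "\<dots> = (1 - (1 - 2 / k)) *\<^sub>R inverse (2 * p) + (1 - 2 / k) *\<^sub>R 0"
      by simp
    finally have "m z = (1 - (1 - 2 / (t + 1))) *\<^sub>R inverse (2 * p) + (1 - 2 / (t + 1)) *\<^sub>R 0"
      by (simp only: k_def)
    moreover have "0 \<le> 1 - 2 / (t + 1)" "1 - 2 / (t + 1) \<le> 1" using t(1) by (simp_all add: field_simps)
    ultimately show ?thesis unfolding closed_segment_def by blast
  qed
  have arcm: "arc (m \<circ> J)"
    unfolding arc_def
  proof
    show "path (m \<circ> J)"
      by (rule path_continuous_image[OF arc_imp_path[OF J(1)]])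
         (use nz in \<open>auto simp: m_def intro!: continuous_intros\<close>)
    have "inj m" unfolding m_def by (intro injI) simp
    thus "inj_on (m \<circ> J) {0..1}" using J(1) unfolding arc_def
      by (intro comp_inj_on) (auto intro: inj_on_subset)
  qed
  have arcT: "arc T" unfolding T_def
  proof (rule arc_join[OF arcm])
    show "arc (linepath (inverse (2 * p)) 0)" using p by (intro arc_linepath) auto
    show "pathfinish (m \<circ> J) = pathstart (linepath (inverse (2 * p)) 0)"
      by (simp add: pathfinish_def J1 m_def)
    show "path_image (m \<circ> J) \<inter> path_image (linepath (inverse (2 * p)) 0) \<subseteq> {pathstart (linepath (inverse (2 * p)) 0)}"
    proof
      fix w assume "w \<in> path_image (m \<circ> J) \<inter> path_image (linepath (inverse (2 * p)) 0)"
      then obtain z where z: "z \<in> path_image J" "w = m z" "w \<in> closed_segment (inverse (2 * p)) 0"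
        by (auto simp: path_image_compose)
      have "w \<noteq> 0" using nz[of z] z(1,2) by (simp add: m_def)
      hence "z \<in> R" using seg_R[OF z(3)] inv_m[of z] z(2) by simp
      hence "z = p" using Jn[OF z(1)] Rn' by fastforce
      thus "w \<in> {pathstart (linepath (inverse (2 * p)) 0)}" using z(2) by (simp add: m_def)
    qed
  qed
  have imT: "path_image T = m ` path_image J \<union> closed_segment (inverse (2 * p)) 0"
    unfolding T_def by (subst path_image_join) (auto simp: pathfinish_def J1 m_def path_image_compose)
  have "connected (- path_image T)" by (rule connected_arc_complement[OF arcT]) simp
  moreover have "S - {-p} = (\<lambda>w. inverse w - p) ` (- path_image T)"
  proof (intro equalityI subsetI)
    fix z assume z: "z \<in> S - {-p}"
    have "z + p \<noteq> 0" using z by (auto simp: add_eq_0_iff2)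
    hence mz: "m z \<noteq> 0" by (simp add: m_def)
    have "m z \<notin> m ` path_image J" using z S inv_m by (metis ComplD DiffD1 UnI1 imageE)
    moreover have "m z \<notin> closed_segment (inverse (2 * p)) 0" using seg_R[OF _ mz] inv_m[of z] z S by auto
    ultimately have "m z \<in> - path_image T" by (simp add: imT)
    thus "z \<in> (\<lambda>w. inverse w - p) ` (- path_image T)" using inv_m[of z] by (metis image_eqI)
  next
    fix z assume "z \<in> (\<lambda>w. inverse w - p) ` (- path_image T)"
    then obtain w where w: "w \<notin> path_image T" "z = inverse w - p" by blast
    have mz: "m z = w" using w(2) m_inv by simp
    have "w \<noteq> 0" using w(1) imT by auto
    hence "z \<noteq> - p" using w(2) by simp
    moreover have "z \<notin> path_image J" using w(1) mz imT by auto
    moreover have "z \<notin> R" using w(1) mz imT R_seg by auto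
    ultimately show "z \<in> S - {-p}" by (simp add: S)
  qed
  moreover have "continuous_on (- path_image T) (\<lambda>w. inverse w - p)"
    using imT by (intro continuous_intros) auto
  ultimately have "connected (S - {-p})" by (simp add: connected_continuous_image)
  moreover have "S \<subseteq> closure (S - {-p})"
  proof -
    have "-p islimpt S" using op mpS by (intro interior_limit_point) (simp add: interior_open)
    hence "-p \<in> closure (S - {-p})" by (simp add: islimpt_in_closure)
    moreover have "S - {-p} \<subseteq> closure (S - {-p})" by (rule closure_subset)
    ultimately show ?thesis by blast
  qed
  ultimately have con: "connected S" by (rule connected_intermediate_closure[of "S - {-p}", OF _ Diff_subset])
  have conC: "connected (- S)"
  proof -
    have "connected R" unfolding R_def by (intro connected_continuous_image continuous_intros) auto
    moreover have "p \<in> path_image J \<inter> R" using pathfinish_in_path_image[of J] J(3)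
      by (auto simp: R_def intro!: image_eqI[of _ _ 1])
    ultimately show ?thesis unfolding S double_complement
      using connected_path_image[OF arc_imp_path[OF J(1)]] by (intro connected_Un) auto
  qed
  have unb: "\<not> bounded (- S)"
  proof
    assume "bounded (- S)"
    then obtain B where B: "\<And>z. z \<in> - S \<Longrightarrow> norm z \<le> B" unfolding bounded_iff by blast
    define t where "t = max 1 ((\<bar>B\<bar> + 1) / norm p)"
    have "of_real t * p \<in> - S" by (auto simp: S R_def t_def)
    hence "t * norm p \<le> B" using B by (force simp: norm_mult t_def)
    moreover have "(\<bar>B\<bar> + 1) / norm p * norm p \<le> t * norm p" by (intro mult_right_mono) (auto simp: t_def)
    ultimately show False using p by simp
  qed
  show "simply_connected S"
    unfolding simply_connected_eq_unbounded_complement_components[OF op]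
  proof (intro conjI ballI con)
    fix C assume C: "C \<in> components (- S)"
    have "- S \<noteq> {}" using unb by force
    hence "components (- S) = {- S}" using conC by (simp add: components_eq_sing_iff)
    thus "\<not> bounded C" using C unb by simp
  qed
  \<comment> \<open>The radial retraction onto the closed disk.\<close>
  define r :: "complex \<Rightarrow> complex" where "r z = (if norm z \<le> norm p then z else of_real (norm p / norm z) * z)" for z
  have rfix: "r z = z" if "norm z \<le> norm p" for z using that by (simp add: r_def)
  have rnorm: "norm (r z) = norm p" if "norm z > norm p" for z
    using that p by (auto simp: r_def norm_mult norm_divide)
  have cr: "continuous_on S r"
  proof -
    have "continuous_on (S \<inter> cball 0 (norm p) \<union> S \<inter> {z. norm p \<le> norm z}) r"
      unfolding r_def
    proof (rule continuous_on_cases_local)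
      show "closedin (top_of_set (S \<inter> cball 0 (norm p) \<union> S \<inter> {z. norm p \<le> norm z})) (S \<inter> cball 0 (norm p))"
        by (auto simp: closedin_closed intro!: exI[of _ "cball 0 (norm p)"])
      have "closed {z::complex. norm p \<le> norm z}" by (intro closed_Collect_le continuous_intros)
      thus "closedin (top_of_set (S \<inter> cball 0 (norm p) \<union> S \<inter> {z. norm p \<le> norm z})) (S \<inter> {z. norm p \<le> norm z})"
        by (auto simp: closedin_closed intro!: exI[of _ "{z. norm p \<le> norm z}"])
      show "continuous_on (S \<inter> cball 0 (norm p)) (\<lambda>z. z)" by (intro continuous_intros)
      show "continuous_on (S \<inter> {z. norm p \<le> norm z}) (\<lambda>z. of_real (norm p / norm z) * z)"
        using p by (intro continuous_intros) auto
    qed auto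
    moreover have "S \<inter> cball 0 (norm p) \<union> S \<inter> {z. norm p \<le> norm z} = S" by auto
    ultimately show ?thesis by simp
  qed
  have rS: "r z \<in> S \<inter> cball 0 (norm p)" if z: "z \<in> S" for z
  proof (cases "norm z \<le> norm p")
    case False
    have "r z \<noteq> p"
    proof
      assume "r z = p"
      hence "of_real (norm p / norm z) * z = p" using False by (simp add: r_def)
      moreover have "z \<noteq> 0" using False by auto
      ultimately have "z = of_real (norm z / norm p) * p" using p by (auto simp: field_simps)
      moreover have "1 \<le> norm z / norm p" using False p by simp
      ultimately have "z \<in> R" unfolding R_def by (intro image_eqI) auto
      thus False using z S by auto
    qed
    thus ?thesis using sph rnorm[of z] False by auto
  qed (use z rfix in auto)
  have "r ` S = S \<inter> cball 0 (norm p)"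
  proof -
    have "z \<in> r ` S" if "z \<in> S" "norm z \<le> norm p" for z using rfix[OF that(2)] that(1) by force
    thus ?thesis using rS by auto
  qed
  moreover have "path_connected S" using con op connected_open_path_connected by blast
  ultimately show "path_connected (S \<inter> cball 0 (norm p))"
    using path_connected_continuous_image[OF cr] by metis
qed

section \<open>The sheets of a branch of the logarithm\<close>

text \<open>
  A branch \<open>L\<close> of the logarithm on a region \<open>S\<close> around \<open>X - {0}\<close> whose part in the disk of radius \<open>\<rho>\<close> is path
  connected. The branch is normalised at one point of the circle, at an angle \<open>\<beta>\<close> strictly between \<open>0\<close> and
  \<open>2 pi\<close>; this fixes the numbering of the sheets relative to the origin.
\<close>
locale log_branch =
  fixes X S :: "complex set" and L :: "complex \<Rightarrow> complex" and \<rho> \<beta> :: real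
  assumes comp: "compact X" and zero: "0 \<in> X" and nontriv: "\<exists>x\<in>X. x \<noteq> 0"
    and \<rho>: "0 < \<rho>" "\<rho> < 1" and X\<rho>: "X \<subseteq> ball 0 \<rho>" and XS: "X - {0} \<subseteq> S"
    and pc: "path_connected (S \<inter> cball 0 \<rho>)"
    and L: "continuous_on S L" and expL: "\<And>z. z \<in> S \<Longrightarrow> exp (L z) = z"
    and \<beta>: "0 < \<beta>" "\<beta> < 2 * pi" and qS: "of_real \<rho> * cis \<beta> \<in> S"
    and Lq: "L (of_real \<rho> * cis \<beta>) = Complex (ln \<rho>) \<beta>"
begin

text \<open>
  The number \<open>n\<close> such that \<open>w = L (exp w) + 2 pi i n\<close>; it is an integer only where \<open>exp w \<in> S\<close>, but real values make
  continuity arguments direct.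
\<close>
definition sheet :: "complex \<Rightarrow> real" where
  "sheet w = Im (w - L (exp w)) / (2 * pi)"

lemma sheet_int:
  assumes "exp w \<in> S"
  obtains n :: int where "sheet w = of_int n" "w = L (exp w) + of_real (2 * pi * of_int n) * \<i>"
proof -
  have "exp w = exp (L (exp w))" using expL[OF assms] by simp
  then obtain n :: int where n: "w = L (exp w) + (of_int (2 * n) * pi) * \<i>"
    unfolding exp_eq by blast
  hence w: "w - L (exp w) = of_real (2 * pi * of_int n) * \<i>" by (simp add: algebra_simps)
  have "sheet w = of_int n" unfolding sheet_def w by simp
  moreover have "w = L (exp w) + of_real (2 * pi * of_int n) * \<i>" using w by (simp add: algebra_simps)
  ultimately show ?thesis using that by blast
qed

lemma sheet_L: "z \<in> S \<Longrightarrow> sheet (L z + of_real (2 * pi * of_int n) * \<i>) = of_int n"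
proof -
  assume z: "z \<in> S"
  have "exp (of_real (2 * pi * of_int n) * \<i>) = 1"
    using exp_integer_2pi[of "of_int n"] by (simp add: mult_ac)
  hence "exp (L z + of_real (2 * pi * of_int n) * \<i>) = z" using expL[OF z] by (simp add: exp_add)
  thus ?thesis by (simp add: sheet_def)
qed

lemma exp_lift_L: "z \<in> S \<Longrightarrow> exp (L z + of_real (2 * pi * of_int n) * \<i>) = z"
  using exp_integer_2pi[of "of_int n"] expL[of z] by (simp add: exp_add mult_ac)

lemma hat_X: "hat X = exp -` X" using zero by (auto simp: hat_def)

lemma hat_S: "w \<in> hat X \<Longrightarrow> exp w \<in> S" using XS by (auto simp: hat_def)

lemma Re_hat: "w \<in> hat X \<Longrightarrow> Re w < ln \<rho>"
proof -
  assume "w \<in> hat X"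
  hence "exp (Re w) < \<rho>" using X\<rho> by (auto simp: hat_def norm_exp_eq_Re[symmetric] simp del: norm_exp_eq_Re)
  thus ?thesis using \<rho>(1) by (metis exp_less_cancel_iff exp_ln)
qed

lemma cont_sheet: "continuous_on (hat X) sheet"
  unfolding sheet_def
  by (intro continuous_intros continuous_on_compose2[OF L]) (use hat_S in auto)

definition upper :: "complex set" where "upper = hat X \<inter> sheet -` {0..}"
text \<open>
  The bound \<open>- 1\<close>, instead of \<open>< 0\<close>, makes this set evidently closed; as sheet numbers are integers, nothing is lost between \<open>- 1\<close>
  and \<open>0\<close>.
\<close>
definition lower :: "complex set" where "lower = hat X \<inter> sheet -` {..-1}"

lemma closed_hat: "closed (hat X)"
  unfolding hat_X by (intro closed_vimage compact_imp_closed comp continuous_intros)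

lemma closed_upper: "closed upper" and closed_lower: "closed lower"
  unfolding upper_def lower_def by (intro continuous_closed_preimage cont_sheet closed_hat; simp)+

lemma upper_Int_lower: "upper \<inter> lower = {}" by (auto simp: upper_def lower_def)

lemma hat_eq_upper_Un_lower: "hat X = upper \<union> lower"
proof -
  have "sheet w \<ge> 0 \<or> sheet w \<le> -1" if w: "w \<in> hat X" for w
  proof -
    obtain n :: int where n: "sheet w = of_int n" using sheet_int[OF hat_S[OF w]] by metis
    show ?thesis unfolding n by (cases "0 \<le> n") (simp, rule disjI2, linarith)
  qed
  thus ?thesis by (auto simp: upper_def lower_def)
qed

lemma in_hat: "x \<in> X \<Longrightarrow> x \<noteq> 0 \<Longrightarrow> L x + of_real (2 * pi * of_int n) * \<i> \<in> hat X"
  using exp_lift_L[of x n] XS by (auto simp: hat_def)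

lemma upper_nonempty: "upper \<noteq> {}" and lower_nonempty: "lower \<noteq> {}"
proof -
  obtain x where x: "x \<in> X" "x \<noteq> 0" using nontriv by blast
  hence "x \<in> S" using XS by blast
  hence "L x + of_real (2 * pi * of_int 0) * \<i> \<in> upper" "L x + of_real (2 * pi * of_int (-1)) * \<i> \<in> lower"
    unfolding upper_def lower_def using in_hat[OF x, of 0] in_hat[OF x, of "-1"] sheet_L[of x 0] sheet_L[of x "-1"] by auto
  thus "upper \<noteq> {}" "lower \<noteq> {}" by blast+
qed

text \<open>
  On \<open>hat X\<close> to the right of \<open>x\<close> the imaginary part differs from \<open>2 pi\<close> times the sheet number by a value of
  \<open>Im L\<close> on the compact set of points of \<open>X\<close> of norm at least \<open>exp x\<close>.
\<close>
lemma half_plane_bounds: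
  "\<exists>y1 y2 :: real. y1 < y2 \<and> Re -` {x..} \<inter> Im -` {y2..} \<inter> lower = {} \<and> Re -` {x..} \<inter> Im -` {..y1} \<inter> upper = {}"
proof -
  define K where "K = X \<inter> {z. exp x \<le> norm z}"
  have "compact K" unfolding K_def by (intro compact_Int_closed comp closed_Collect_le continuous_intros)
  moreover have "K \<subseteq> S" using XS by (auto simp: K_def)
  ultimately have "compact (L ` K)" by (intro compact_continuous_image continuous_on_subset[OF L])
  hence "bounded (L ` K)" by (rule compact_imp_bounded)
  then obtain M where M: "\<forall>z\<in>K. norm (L z) \<le> M" unfolding bounded_iff by (metis imageI)
  have im: "\<bar>Im w - 2 * pi * sheet w\<bar> \<le> M" if w: "w \<in> hat X" "x \<le> Re w" for w
  proof -
    have "exp w \<in> K" using w by (auto simp: K_def hat_def norm_exp_eq_Re)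
    hence "\<bar>Im (L (exp w))\<bar> \<le> M" using M abs_Im_le_cmod order.trans by blast
    moreover have "Im w - 2 * pi * sheet w = Im (L (exp w))" by (simp add: sheet_def)
    ultimately show ?thesis by simp
  qed
  have lo: "Im w < \<bar>M\<bar> + 1" if "w \<in> lower" "x \<le> Re w" for w
  proof -
    have "pi * sheet w \<le> 0" using that(1) by (auto simp: lower_def mult_le_0_iff)
    moreover have "\<bar>Im w - 2 * (pi * sheet w)\<bar> \<le> M" using im[of w] that by (simp add: lower_def mult.assoc)
    ultimately show ?thesis by linarith
  qed
  have up: "- \<bar>M\<bar> - 1 < Im w" if "w \<in> upper" "x \<le> Re w" for w
  proof -
    have "0 \<le> pi * sheet w" using that(1) by (auto simp: upper_def)
    moreover have "\<bar>Im w - 2 * (pi * sheet w)\<bar> \<le> M" using im[of w] that by (simp add: upper_def mult.assoc)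
    ultimately show ?thesis by linarith
  qed
  show ?thesis
  proof (intro exI conjI)
    show "- \<bar>M\<bar> - 1 < \<bar>M\<bar> + 1" by linarith
    show "Re -` {x..} \<inter> Im -` {\<bar>M\<bar> + 1..} \<inter> lower = {}" using lo by force
    show "Re -` {x..} \<inter> Im -` {..- \<bar>M\<bar> - 1} \<inter> upper = {}" using up by force
  qed
qed

text \<open>
  A path in the disk part of \<open>S\<close> from \<open>exp w\<close> to the point of normalisation lifts to the sheet of \<open>w\<close>.
\<close>
lemma sheet_path:
  assumes w: "w \<in> hat X" and n: "sheet w = of_int n"
  obtains s where "path s" "pathstart s = w" "pathfinish s = Complex (ln \<rho>) (\<beta> + 2 * pi * of_int n)"
    "\<And>z. z \<in> path_image s \<Longrightarrow> sheet z = of_int n \<and> Re z \<le> ln \<rho>"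
proof -
  have wX: "exp w \<in> X" using w by (auto simp: hat_def)
  hence "exp w \<in> S \<inter> cball 0 \<rho>" using hat_S[OF w] X\<rho> by (auto simp: subset_iff less_imp_le)
  moreover have "of_real \<rho> * cis \<beta> \<in> S \<inter> cball 0 \<rho>" using qS \<rho> by (auto simp: norm_mult)
  ultimately obtain c where c: "path c" "path_image c \<subseteq> S \<inter> cball 0 \<rho>" "pathstart c = exp w" "pathfinish c = of_real \<rho> * cis \<beta>"
    using pc unfolding path_connected_def by meson
  define s where "s t = L (c t) + of_real (2 * pi * of_int n) * \<i>" for t
  have cS: "c t \<in> S \<inter> cball 0 \<rho>" if "t \<in> {0..1}" for t using c(2) that unfolding path_image_def by blast
  show ?thesis
  proof
    show "path s" using c(1) cS unfolding path_def s_def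
      by (intro continuous_intros continuous_on_compose2[OF L]) auto
    obtain n' :: int where n': "sheet w = of_int n'" "w = L (exp w) + of_real (2 * pi * of_int n') * \<i>"
      using sheet_int[OF hat_S[OF w]] by metis
    hence "n' = n" using n by simp
    thus "pathstart s = w" using c(3) n'(2) by (simp add: pathstart_def s_def)
    have "c 1 = of_real \<rho> * cis \<beta>" using c(4) by (simp add: pathfinish_def)
    thus "pathfinish s = Complex (ln \<rho>) (\<beta> + 2 * pi * of_int n)"
      unfolding pathfinish_def s_def by (simp only: Lq) (simp add: complex_eq_iff)
    fix z assume "z \<in> path_image s"
    then obtain t where t: "t \<in> {0..1}" "z = s t" by (auto simp: path_image_def)
    have "sheet z = of_int n" using sheet_L[of "c t" n] cS[OF t(1)] t(2) by (simp add: s_def)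
    moreover have "Re z \<le> ln \<rho>"
    proof -
      have "exp z = c t" using exp_lift_L[of "c t" n] cS[OF t(1)] t(2) by (simp add: s_def)
      hence "exp (Re z) \<le> \<rho>" using cS[OF t(1)] by (auto simp flip: norm_exp_eq_Re)
      thus ?thesis using \<rho>(1) by (simp add: ln_ge_iff)
    qed
    ultimately show "sheet z = of_int n \<and> Re z \<le> ln \<rho>" by blast
  qed
qed

lemma sheet_corner: "sheet (Complex (ln \<rho>) (\<beta> + 2 * pi * of_int n)) = of_int n"
proof -
  have "Complex (ln \<rho>) (\<beta> + 2 * pi * of_int n) = L (of_real \<rho> * cis \<beta>) + of_real (2 * pi * of_int n) * \<i>"
    by (simp add: Lq complex_eq_iff)
  thus ?thesis using sheet_L[OF qS] by simp
qed

lemma in_segment_coords: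
  "z \<in> closed_segment (Complex a y) (Complex b y) \<Longrightarrow> a \<le> b \<Longrightarrow> Im z = y \<and> a \<le> Re z \<and> Re z \<le> b"
  "z \<in> closed_segment (Complex x c) (Complex x d) \<Longrightarrow> Re z = x \<and> min c d \<le> Im z \<and> Im z \<le> max c d"
  by (auto simp: closed_segment_same_Im closed_segment_same_Re closed_segment_eq_real_ivl split: if_splits)

text \<open>
  Let \<open>m < 0\<close> be the sheet of a point of \<open>D\<close>. The path from \<open>D\<close> to \<open>0\<close> stays in sheet \<open>m\<close> until it reaches the height
  \<open>\<beta> + 2 pi m < 0\<close> at real part \<open>ln \<rho>\<close>, continues horizontally to the imaginary axis, and climbs to \<open>0\<close>. A point of \<open>C\<close>, in a
  sheet \<open>n \<ge> 0\<close>, is joined to \<open>1 + 2 pi i\<close> within sheet \<open>n\<close>, then horizontally at the height \<open>\<beta> + 2 pi n > 0\<close> to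
  real part \<open>1\<close>, and then vertically. The two connections are separated by their sheet numbers to the left
  of \<open>ln \<rho>\<close> and by the sign of their heights to the right of it.
\<close>
lemma lies_above_sheets:
  assumes C: "C \<subseteq> upper" and D: "D \<subseteq> lower" "D \<noteq> {}"
  shows "lies_above C D"
proof -
  have ln\<rho>: "ln \<rho> < 0" using \<rho> by simp
  obtain d where d: "d \<in> D" using D(2) by blast
  hence dh: "d \<in> hat X" "sheet d \<le> -1" using D(1) by (auto simp: lower_def)
  obtain m :: int where m: "sheet d = of_int m" using sheet_int[OF hat_S[OF dh(1)]] by metis
  have m1: "m \<le> -1" using dh(2) m by linarith
  have "of_int m \<le> (-1::real)" using m1 by linarith
  hence "2 * pi * of_int m \<le> 2 * pi * (-1)" by (intro mult_left_mono) auto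
  hence low: "\<beta> + 2 * pi * of_int m < 0" using \<beta>(2) by linarith
  obtain s1 where s1: "path s1" "pathstart s1 = d" "pathfinish s1 = Complex (ln \<rho>) (\<beta> + 2 * pi * of_int m)"
    "\<And>z. z \<in> path_image s1 \<Longrightarrow> sheet z = of_int m \<and> Re z \<le> ln \<rho>"
    using sheet_path[OF dh(1) m] by blast
  define s2 where "s2 = linepath (Complex (ln \<rho>) (\<beta> + 2 * pi * of_int m)) (Complex 0 (\<beta> + 2 * pi * of_int m))"
  define s3 where "s3 = linepath (Complex 0 (\<beta> + 2 * pi * of_int m)) (Complex 0 0)"
  have s2: "Im z = \<beta> + 2 * pi * of_int m \<and> ln \<rho> \<le> Re z \<and> Re z \<le> 0" if "z \<in> path_image s2" for z
    using in_segment_coords(1)[of z "ln \<rho>" _ 0] that ln\<rho> by (simp add: s2_def)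
  have s3: "Re z = 0 \<and> Im z \<le> 0" if "z \<in> path_image s3" for z
    using in_segment_coords(2)[of z 0 "\<beta> + 2 * pi * of_int m" 0] that low by (simp add: s3_def max_def)
  define s where "s = s1 +++ s2 +++ s3"
  have s: "path s" "pathstart s = d" "pathfinish s = 0"
    unfolding s_def using s1(1-3) by (auto simp: s2_def s3_def complex_eq_iff intro!: path_join_imp)
  have ims: "path_image s = path_image s1 \<union> path_image s2 \<union> path_image s3"
    unfolding s_def using s1 by (subst path_image_join path_image_join; simp add: s2_def s3_def Un_assoc path_image_join)+
  define R where "R = path_image s \<union> complex_of_real ` {0..}"
  have Re_s: "Re z \<le> 0" if "z \<in> path_image s" for z
    using that s1(4)[of z] s2[of z] s3[of z] ln\<rho> unfolding ims by auto
  have avoidC: "z \<notin> C" if "z \<in> path_image s" for z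
  proof
    assume "z \<in> C"
    hence "0 \<le> sheet z" "Re z < ln \<rho>" using C Re_hat by (auto simp: upper_def)
    thus False using that s1(4)[of z] s2[of z] s3[of z] ln\<rho> m1 unfolding ims by auto
  qed
  have "C \<subseteq> connected_component_set (- (D \<union> R)) (Complex 1 (2 * pi))"
  proof
    fix c assume c: "c \<in> C"
    hence ch: "c \<in> hat X" "0 \<le> sheet c" using C by (auto simp: upper_def)
    obtain n :: int where n: "sheet c = of_int n" using sheet_int[OF hat_S[OF ch(1)]] by metis
    have n0: "n \<ge> 0" using ch(2) n by linarith
    hence "0 \<le> 2 * pi * real_of_int n" by simp
    hence high: "0 < \<beta> + 2 * pi * of_int n" using \<beta>(1) by linarith
    obtain t1 where t1: "path t1" "pathstart t1 = c" "pathfinish t1 = Complex (ln \<rho>) (\<beta> + 2 * pi * of_int n)"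
      "\<And>z. z \<in> path_image t1 \<Longrightarrow> sheet z = of_int n \<and> Re z \<le> ln \<rho>"
      using sheet_path[OF ch(1) n] by blast
    define t2 where "t2 = linepath (Complex (ln \<rho>) (\<beta> + 2 * pi * of_int n)) (Complex 1 (\<beta> + 2 * pi * of_int n))"
    define t3 where "t3 = linepath (Complex 1 (\<beta> + 2 * pi * of_int n)) (Complex 1 (2 * pi))"
    have t2: "Im z = \<beta> + 2 * pi * of_int n \<and> ln \<rho> \<le> Re z" if "z \<in> path_image t2" for z
      using in_segment_coords(1)[of z "ln \<rho>" _ 1] that ln\<rho> by (simp add: t2_def)
    have t3: "Re z = 1 \<and> 0 < Im z" if "z \<in> path_image t3" for z
      using in_segment_coords(2)[of z 1 "\<beta> + 2 * pi * of_int n" "2 * pi"] that high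
      by (simp add: t3_def min_def split: if_splits) (use pi_gt_zero in linarith)+
    define t where "t = t1 +++ t2 +++ t3"
    have t: "path t" "pathstart t = c" "pathfinish t = Complex 1 (2 * pi)"
      unfolding t_def using t1(1-3) by (auto simp: t2_def t3_def intro!: path_join_imp)
    have imt: "path_image t = path_image t1 \<union> path_image t2 \<union> path_image t3"
      unfolding t_def using t1 by (subst path_image_join path_image_join; simp add: t2_def t3_def Un_assoc path_image_join)+
    have "z \<notin> D \<union> R" if z: "z \<in> path_image t" for z
    proof
      assume zDR: "z \<in> D \<union> R"
      have Dz: "sheet z \<le> -1 \<and> Re z < ln \<rho>" if "z \<in> D"
        using that D(1) Re_hat by (auto simp: lower_def)
      have Rz: "Re z \<ge> 0 \<and> Im z = 0" if "z \<in> complex_of_real ` {0..}"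
        using that by auto
      have nm: "real_of_int n \<noteq> of_int m" using n0 m1 by simp
      consider "z \<in> path_image t1" | "z \<in> path_image t2" | "z \<in> path_image t3" using z imt by blast
      thus False
      proof cases
        case 1
        have "z \<notin> path_image s2"
        proof
          assume "z \<in> path_image s2"
          hence "z = Complex (ln \<rho>) (\<beta> + 2 * pi * of_int m)"
            using s2[of z] t1(4)[OF 1] by (auto simp: complex_eq_iff intro: antisym)
          thus False using sheet_corner[of m] t1(4)[OF 1] nm by simp
        qed
        thus False using zDR Dz Rz t1(4)[OF 1] s1(4)[of z] s3[of z] ln\<rho> n0 nm unfolding R_def ims by auto
      next
        case 2
        have "z \<notin> path_image s1"
        proof
          assume "z \<in> path_image s1"
          hence "z = Complex (ln \<rho>) (\<beta> + 2 * pi * of_int n)" "sheet z = of_int m"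
            using s1(4)[of z] t2[OF 2] by (auto simp: complex_eq_iff intro: antisym)
          thus False using sheet_corner[of n] nm by simp
        qed
        thus False using zDR Dz Rz t2[OF 2] s2[of z] s3[of z] low high unfolding R_def ims by auto
      next
        case 3
        thus False using zDR Dz Rz t3[OF 3] Re_s[of z] ln\<rho> unfolding R_def by auto
      qed
    qed
    hence "path_image t \<subseteq> - (D \<union> R)" by blast
    moreover have "c \<in> path_image t" "Complex 1 (2 * pi) \<in> path_image t"
      using t pathstart_in_path_image[of t] pathfinish_in_path_image[of t] by auto
    moreover have "connected (path_image t)" by (rule connected_path_image[OF t(1)])
    ultimately show "c \<in> connected_component_set (- (D \<union> R)) (Complex 1 (2 * pi))"
      unfolding connected_component_def by blast
  qed
  moreover have "path_image s \<subseteq> Re -` {..0} - C" using Re_s avoidC by auto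
  ultimately show ?thesis
    unfolding lies_above_def Let_def R_def using s d by (intro exI[of _ s]) auto
qed

lemma upper_lies_above_lower: "lies_above_set upper lower"
  unfolding lies_above_set_def
  using lies_above_sheets in_components_subset in_components_nonempty by metis

end

section \<open>The equivalence\<close>

text \<open>
  The landing ray provides the slit, the slit plane the branch of the logarithm, and its sheets the two parts.
\<close>
theorem separated_if_accessible:
  assumes comp: "compact X" and nontriv: "\<exists>x\<in>X. x \<noteq> 0" and X1: "X \<subseteq> ball 0 1" and acc: "accessible X 0"
  shows "\<exists>A B. hat X = A \<union> B \<and> A \<noteq> {} \<and> B \<noteq> {} \<and> A \<inter> B = {} \<and> closed A \<and> closed B \<and>
       lies_above_set A B \<and>
       (\<forall>x::real. \<exists>y1 y2 :: real. y1 < y2 \<and>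
          Re -` {x..} \<inter> Im -` {y2..} \<inter> B = {} \<and>
          Re -` {x..} \<inter> Im -` {..y1} \<inter> A = {})"
proof -
  obtain \<phi> \<theta> where \<phi>: "exterior_conformal_iso X \<phi>" "ray_lands \<phi> \<theta> 0" and zero: "0 \<in> X"
    using acc by (auto simp: accessible_def)
  interpret exterior_map X \<phi> by unfold_locales (use \<phi> comp zero in auto)
  obtain \<rho> where \<rho>: "0 < \<rho>" "\<rho> < 1" "X \<subseteq> ball 0 \<rho>"
  proof -
    obtain x where x: "x \<in> X" "\<And>y. y \<in> X \<Longrightarrow> norm y \<le> norm x"
      using continuous_attains_sup[OF comp, of norm] zero by (auto intro: continuous_intros)
    show ?thesis
    proof (rule that[of "(norm x + 1) / 2"])
      have nx: "norm x < 1" using x(1) X1 by auto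
      show "0 < (norm x + 1) / 2" by (simp add: add_nonneg_pos)
      show "(norm x + 1) / 2 < 1" using nx by simp
      have "norm y < (norm x + 1) / 2" if "y \<in> X" for y using x(2)[OF that] nx by (simp add: field_simps)
      thus "X \<subseteq> ball 0 ((norm x + 1) / 2)" by auto
    qed
  qed
  obtain J where J: "arc J" "pathstart J = 0" "norm (pathfinish J) = \<rho>"
    "\<And>t. t \<in> {0..1} \<Longrightarrow> t \<noteq> 1 \<Longrightarrow> norm (J t) < \<rho>" "path_image J \<inter> X \<subseteq> {0}"
    using end_of_landing_ray[OF \<phi>(2) \<rho>(1)] by blast
  define p where "p = pathfinish J"
  have p: "p \<noteq> 0" "norm p = \<rho>" using J(3) \<rho>(1) by (auto simp: p_def)
  define S where "S = - (path_image J \<union> (\<lambda>t. of_real t * p) ` {1..})"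
  have S: "open S" "simply_connected S" "path_connected (S \<inter> cball 0 \<rho>)" "sphere 0 \<rho> - {p} \<subseteq> S"
    using slit_plane[of J p] J p unfolding S_def by (simp_all add: p_def)
  have zS: "0 \<notin> S" using pathstart_in_path_image[of J] J(2) by (auto simp: S_def)
  have XS: "X - {0} \<subseteq> S"
  proof
    fix x assume x: "x \<in> X - {0}"
    have "x \<noteq> of_real t * p" if "1 \<le> t" for t
    proof
      assume "x = of_real t * p"
      hence "norm x = t * \<rho>" using p(2) that by (simp add: norm_mult)
      moreover have "1 * \<rho> \<le> t * \<rho>" using that \<rho>(1) by (intro mult_right_mono) auto
      ultimately show False using x \<rho>(3) by auto
    qed
    thus "x \<in> S" using x J(5) by (auto simp: S_def)
  qed
  \<comment> \<open>Any angle strictly between \<open>0\<close> and \<open>2 pi\<close> that avoids the slit will do.\<close>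
  define \<beta> where "\<beta> = (if p = of_real \<rho> * cis (pi / 2) then pi else pi / 2)"
  have \<beta>: "0 < \<beta>" "\<beta> < 2 * pi" by (auto simp: \<beta>_def)
  define q where "q = of_real \<rho> * cis \<beta>"
  have "q \<noteq> p" using \<rho>(1) by (auto simp: q_def \<beta>_def complex_eq_iff)
  hence qS: "q \<in> S" using S(4) \<rho>(1) by (auto simp: q_def norm_mult)
  have "\<exists>g. continuous_on S g \<and> (\<forall>z\<in>S. z = exp (g z))"
    using S(2) zS unfolding simply_connected_eq_continuous_log[OF S(1)]
    by (metis (no_types, lifting) continuous_on_id)
  then obtain L0 where L0: "continuous_on S L0" "\<And>z. z \<in> S \<Longrightarrow> exp (L0 z) = z" by metis
  have "exp (Complex (ln \<rho>) \<beta>) = q" using \<rho>(1) by (simp add: q_def exp_eq_polar)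
  hence "exp (Complex (ln \<rho>) \<beta>) = exp (L0 q)" using L0(2)[OF qS] by simp
  hence e1: "exp (Complex (ln \<rho>) \<beta> - L0 q) = 1" by (simp add: exp_diff)
  define L where "L z = L0 z + (Complex (ln \<rho>) \<beta> - L0 q)" for z
  interpret log_branch X S L \<rho> \<beta>
  proof
    show "continuous_on S L" unfolding L_def by (intro continuous_intros L0)
    show "exp (L z) = z" if "z \<in> S" for z unfolding L_def exp_add e1 using L0(2)[OF that] by simp
    show "L (of_real \<rho> * cis \<beta>) = Complex (ln \<rho>) \<beta>" by (simp add: L_def q_def)
    show "of_real \<rho> * cis \<beta> \<in> S" using qS by (simp add: q_def)
  qed (use comp zero nontriv \<rho> XS S(3) \<beta> in auto)
  show ?thesis
    by (intro exI[of _ upper] exI[of _ lower] conjI allI hat_eq_upper_Un_lower upper_nonempty lower_nonempty upper_Int_lower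
        closed_upper closed_lower upper_lies_above_lower half_plane_bounds)
qed

theorem lemma3p1:
  fixes X :: "complex set"
  assumes "nondegenerate_nonseparating_continuum X"
    and "0 \<in> frontier X"
    and "X \<subseteq> ball 0 1"
  shows "accessible X 0 \<longleftrightarrow>
    (\<exists>A B. hat X = A \<union> B \<and> A \<noteq> {} \<and> B \<noteq> {} \<and> A \<inter> B = {} \<and> closed A \<and> closed B \<and>
       lies_above_set A B \<and>
       (\<forall>x::real. \<exists>y1 y2 :: real. y1 < y2 \<and>
          Re -` {x..} \<inter> Im -` {y2..} \<inter> B = {} \<and>
          Re -` {x..} \<inter> Im -` {..y1} \<inter> A = {}))" (is "_ \<longleftrightarrow> ?sep")
proof
  have comp: "compact X" and con: "connected X" and con': "connected (- X)"
    using assms(1) by (auto simp: nondegenerate_nonseparating_continuum_def)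
  obtain a where a: "a \<in> X" "a \<noteq> 0"
    using assms(1) by (auto simp: nondegenerate_nonseparating_continuum_def)
  {
    assume "accessible X 0"
    thus ?sep using a by (intro separated_if_accessible comp assms(3)) auto
  next
    assume ?sep
    then obtain A B where AB: "hat X = A \<union> B" "A \<noteq> {}" "B \<noteq> {}" "A \<inter> B = {}" "closed A" "closed B"
      and bd: "\<And>x::real. \<exists>y1 y2 :: real. y1 < y2 \<and> Re -` {x..} \<inter> Im -` {y2..} \<inter> B = {} \<and>
          Re -` {x..} \<inter> Im -` {..y1} \<inter> A = {}"
      by (elim exE conjE) blast
    have zero: "0 \<in> X" using assms(2) comp compact_imp_closed frontier_subset_closed by blast
    obtain \<phi> where \<phi>: "exterior_conformal_iso X \<phi>"
      using ex_exterior_conformal_iso[OF comp con con' zero a] by blast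
    interpret exterior_map X \<phi> by unfold_locales (use \<phi> comp zero in auto)
    have hB: "\<exists>y. \<forall>z\<in>B. x \<le> Re z \<longrightarrow> Im z < y" for x
    proof -
      obtain y where "Re -` {x..} \<inter> Im -` {y..} \<inter> B = {}" using bd by blast
      thus ?thesis by (intro exI[of _ y]) (force simp: not_le)
    qed
    have hA: "\<exists>y. \<forall>z\<in>A. x \<le> Re z \<longrightarrow> y < Im z" for x
    proof -
      obtain y where "Re -` {x..} \<inter> Im -` {..y} \<inter> A = {}" using bd by blast
      thus ?thesis by (intro exI[of _ y]) (force simp: not_le)
    qed
    obtain \<theta> where "ray_lands \<phi> \<theta> 0"
      using landing_ray_if_separated[OF AB(1,4,5,6,2,3) hB hA] by blast
    thus "accessible X 0" unfolding accessible_def using zero \<phi> by blast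
  }
qed

end
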